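(* Let $G$ be a finitely generated solvable group. Then $G$ is discriminating if and only if $G$ is isomorphic to $\mathbb{Z}^n$ for some integer $n \ge 0$.
   Context: A group $G$ is called discriminating if for every integer $N$ and every elements $h_1,\dots,h_N \in G\times G$ there exists a group homomorphism $\rho: G\times G \to G$ such that, for each $i$, $\rho(h_i)=1$ if and only if $h_i=1$. *)

theory Defs
  imports "HOL-Algebra.Algebra"
begin

definition finitely_generated_group :: "('a, 'b) monoid_scheme \<Rightarrow> bool" where
  "finitely_generated_group G \<longleftrightarrow>
     (\<exists>S. finite S \<and> S \<subseteq> carrier G \<and> generate G S = carrier G)"

definition discriminating :: "('a, 'b) monoid_scheme \<Rightarrow> bool" where
  "discriminating G \<longleftrightarrow>
     (\<forall>(N::nat) (h :: nat \<Rightarrow> 'a \<times> 'a).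
        (\<forall>i<N. h i \<in> carrier (G \<times>\<times> G)) \<longrightarrow>
        (\<exists>\<rho> \<in> hom (G \<times>\<times> G) G.
           \<forall>i<N. \<rho> (h i) = \<one>\<^bsub>G\<^esub> \<longleftrightarrow> h i = \<one>\<^bsub>G \<times>\<times> G\<^esub>))"

definition Zpow :: "nat \<Rightarrow> (nat \<Rightarrow> int) monoid" where
  "Zpow n = product_group {..<n} (\<lambda>_. integer_group)"

end

theory Submission
  imports Defs "HOL-Computational_Algebra.Primes"
begin

text \<open>
  Suppose \<open>G\<close> is discriminating, finitely generated and solvable. Iterating \<open>G \<times> G \<rightarrow> G\<close> gives, for every
  \<open>m\<close>, endomorphisms \<open>\<phi> 0, \<dots>, \<phi> (m - 1)\<close> of \<open>G\<close> with commuting images that do not kill a fixed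
  element of the last nontrivial derived subgroup. If \<open>G\<close> is not abelian, then no \<open>\<phi> i\<close> maps \<open>G'\<close>
  into \<open>G''\<close>, since it would then kill this last derived subgroup; so \<open>G / G''\<close> contains
  pairs \<open>(x i, y i)\<close>, for \<open>i < m\<close>, that do not commute although all elements with different
  indices do.

  In a finitely generated metabelian group \<open>P\<close> the number of such pairs is bounded. By Hall's theorem
  one may assume, by noetherian induction, that the bound holds in all proper quotients \<open>P / K\<close> with
  \<open>K \<subseteq> P'\<close>. Then the module \<open>P'\<close> is meet-irreducible or \<open>P\<close> embeds into the product of two of
  these quotients. In the irreducible case every operator on \<open>P'\<close> is injective or nilpotent. Each
  \<open>x i\<close> and \<open>y i\<close> fixes a commutator of another pair, hence acts unipotently, and there is a prime
  \<open>p\<close> such that \<open>a^n = 1\<close> with \<open>p \<nmid> n\<close> forces \<open>a = 1\<close> in \<open>P'\<close>. As \<open>P / P'\<close> has bounded rank,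
  products of powers of the \<open>x i\<close> and of the \<open>y i\<close> lie in the abelian group \<open>P'\<close>, and unipotency
  turns their commuting into the commuting of some \<open>x i\<close> and \<open>y i\<close>.

  In the abelian case a maximal finite subgroup \<open>F\<close> contains an isomorphic copy of \<open>F \<times> F\<close>, so \<open>G\<close>
  is torsion-free. Conversely, \<open>(a, b) \<mapsto> a b^M\<close> discriminates for all but finitely many \<open>M\<close>.
\<close>

subsection \<open>Ascending chains of invariant subgroups\<close>

definition conj_closed :: "('a, 'b) monoid_scheme \<Rightarrow> 'a set \<Rightarrow> 'a set \<Rightarrow> bool" where
  "conj_closed G W N \<longleftrightarrow> (\<forall>w\<in>W. \<forall>a\<in>N. w \<otimes>\<^bsub>G\<^esub> a \<otimes>\<^bsub>G\<^esub> inv\<^bsub>G\<^esub> w \<in> N)"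

text \<open>With \<open>W = {}\<close> this is the chain condition for all subgroups of
  \<open>G\<close> inside \<open>M\<close>, with \<open>W = carrier G\<close> the one for normal
  subgroups of \<open>G\<close> inside \<open>M\<close>. A variable \<open>W\<close> lets operators
  be adjoined one at a time.\<close>

definition noeth_under :: "('a, 'b) monoid_scheme \<Rightarrow> 'a set \<Rightarrow> 'a set \<Rightarrow> bool" where
  "noeth_under G W M \<longleftrightarrow>
    (\<forall>N :: nat \<Rightarrow> 'a set.
       (\<forall>i. subgroup (N i) G \<and> N i \<subseteq> M \<and> conj_closed G W (N i) \<and> N i \<subseteq> N (Suc i)) \<longrightarrow>
       (\<exists>n. \<forall>k\<ge>n. N k = N n))"

lemma noeth_underD:
  assumes "noeth_under G W M"
    and "\<And>i. subgroup (N i) G" "\<And>i. N i \<subseteq> M" "\<And>i. conj_closed G W (N i)" "\<And>i. N i \<subseteq> N (Suc i)"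
  shows "\<exists>n. \<forall>k\<ge>n. N k = N n"
  using assms unfolding noeth_under_def by blast

text \<open>If every candidate could be enlarged, dependent choice would produce a strictly
  increasing chain.\<close>

lemma noeth_under_maximal:
  assumes N: "noeth_under G W M" and K0: "subgroup K0 G" "K0 \<subseteq> M" "conj_closed G W K0" "P K0"
  obtains K where "subgroup K G" "K \<subseteq> M" "conj_closed G W K" "P K"
    "\<And>K'. subgroup K' G \<Longrightarrow> K' \<subseteq> M \<Longrightarrow> conj_closed G W K' \<Longrightarrow> P K' \<Longrightarrow> K \<subseteq> K' \<Longrightarrow> K' = K"
proof (rule ccontr)
  define Q where "Q K \<longleftrightarrow> subgroup K G \<and> K \<subseteq> M \<and> conj_closed G W K \<and> P K" for K
  assume "\<not> thesis"
  then have "\<forall>K. Q K \<longrightarrow> (\<exists>K'. Q K' \<and> K \<subset> K')"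
    using that unfolding Q_def by (metis psubsetI)
  moreover have "Q K0" using K0 by (simp add: Q_def)
  ultimately obtain N where N0: "\<And>n. Q (N n) \<and> N n \<subset> N (Suc n)"
    using dependent_nat_choice[of "\<lambda>_. Q" "\<lambda>_ K K'. K \<subset> K'"] by metis
  then have "\<exists>n. \<forall>k\<ge>n. N k = N n"
    unfolding Q_def by (intro noeth_underD[OF N, of N]) auto
  then obtain n where "N (Suc n) = N n" by (meson le_SucI order_refl)
  with N0[of n] show False by simp
qed

text \<open>The least positive integer \<open>d\<close> occurring in any \<open>L i\<close> divides
  all elements of all \<open>L k\<close>, because remainders modulo \<open>d\<close> occur again in
  some group of the chain. From a stage containing \<open>d\<close> on, every group consists of the
  multiples of \<open>d\<close>.\<close>

lemma int_subgroup_chain_stable: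
  fixes L :: "nat \<Rightarrow> int set"
  assumes zero: "\<And>i. 0 \<in> L i" and diff: "\<And>i x y. x \<in> L i \<Longrightarrow> y \<in> L i \<Longrightarrow> x - y \<in> L i"
    and mono: "\<And>i. L i \<subseteq> L (Suc i)"
  shows "\<exists>n. \<forall>k\<ge>n. L k = L n"
proof -
  have incr: "L i \<subseteq> L j" if "i \<le> j" for i j
    using that mono lift_Suc_mono_le[of L] by blast
  have neg: "- x \<in> L i" if "x \<in> L i" for x i
    using diff[OF zero that] by simp
  have add: "x + y \<in> L i" if "x \<in> L i" "y \<in> L i" for x y i
    using diff[OF that(1) neg[OF that(2)]] by simp
  have nmult: "int k * x \<in> L i" if "x \<in> L i" for x i k
    by (induction k) (use that zero add in \<open>auto simp: algebra_simps\<close>)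
  have mult: "k * x \<in> L i" if "x \<in> L i" for x i k
    using nmult[OF that, of "nat k"] neg[OF nmult[OF that, of "nat (- k)"]] by (cases "k \<ge> 0") auto
  show ?thesis
  proof (cases "\<exists>i. \<exists>x\<in>L i. x \<noteq> 0")
    case False
    then have "L i = {0}" for i using zero by blast
    then show ?thesis by simp
  next
    case True
    define D where "D d \<longleftrightarrow> d > 0 \<and> (\<exists>i. int d \<in> L i)" for d :: nat
    obtain i x where ix: "x \<in> L i" "x \<noteq> 0" using True by blast
    have "\<bar>x\<bar> \<in> L i" using ix neg by (simp add: abs_if)
    then have "D (nat \<bar>x\<bar>)" using ix by (auto simp: D_def)
    define d where "d = (LEAST d. D d)"
    have "D d" unfolding d_def using \<open>D (nat \<bar>x\<bar>)\<close> by (rule LeastI)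
    then obtain n where d: "d > 0" "int d \<in> L n" by (auto simp: D_def)
    have dvd: "int d dvd u" if u: "u \<in> L k" for u k
    proof -
      have "u - (u div int d) * int d \<in> L (max k n)"
        using u d incr[of k "max k n"] incr[of n "max k n"] by (intro diff mult) auto
      then have m: "u mod int d \<in> L (max k n)" by (simp add: minus_div_mult_eq_mod)
      have "u mod int d = 0"
      proof (rule ccontr)
        assume "u mod int d \<noteq> 0"
        moreover have "0 \<le> u mod int d" using d by (intro pos_mod_sign) simp
        ultimately have "0 < nat (u mod int d)" "int (nat (u mod int d)) = u mod int d" by simp_all
        with m have "D (nat (u mod int d))" unfolding D_def by metis
        then have "d \<le> nat (u mod int d)" unfolding d_def by (rule Least_le)
        then show False using d pos_mod_bound[of "int d" u] by linarith
      qed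
      then show ?thesis by auto
    qed
    have "L k = L n" if "k \<ge> n" for k
    proof
      show "L n \<subseteq> L k" using incr that by simp
      show "L k \<subseteq> L n" using dvd mult[OF d(2)] by (metis dvdE mult.commute subsetI)
    qed
    then show ?thesis by blast
  qed
qed

context group
begin

lemma generate_commute:
  assumes "x \<in> carrier G" "T \<subseteq> carrier G" "\<And>t. t \<in> T \<Longrightarrow> x \<otimes> t = t \<otimes> x" "y \<in> generate G T"
  shows "x \<otimes> y = y \<otimes> x"
  using assms(4)
proof (induction rule: generate.induct)
  case one show ?case using assms by simp
next
  case (incl h) then show ?case using assms by simp
next
  case (inv h)
  then have "h \<in> carrier G" "x \<otimes> h = h \<otimes> x" using assms by auto
  then show ?case
    by (metis assms(1) inv_closed inv_solve_left inv_solve_right m_assoc m_closed)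
next
  case (eng h1 h2)
  then have "h1 \<in> carrier G" "h2 \<in> carrier G" using generate_in_carrier[OF assms(2)] by auto
  then show ?case using eng assms(1) by (metis m_assoc)
qed

lemma generate_commute_generate:
  assumes "S \<subseteq> carrier G" "T \<subseteq> carrier G" "\<And>s t. s \<in> S \<Longrightarrow> t \<in> T \<Longrightarrow> s \<otimes> t = t \<otimes> s"
    "x \<in> generate G S" "y \<in> generate G T"
  shows "x \<otimes> y = y \<otimes> x"
proof -
  have "y \<otimes> s = s \<otimes> y" if "s \<in> S" for s
    using generate_commute[of s T y] assms that by (metis subsetD)
  then show ?thesis
    using generate_commute[of y S x] assms generate_in_carrier by metis
qed

text \<open>Dividing an element of \<open>N'\<close> by one of \<open>N\<close> with the same
  leading term leaves an element of \<open>N' \<inter> M\<close>, hence of \<open>N\<close>. Both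
  chain arguments below end with this comparison.\<close>

lemma subset_by_leading_terms:
  assumes "subgroup N G" "subgroup N' G" "N \<subseteq> N'" "N' \<inter> M \<subseteq> N"
    and "\<And>x. x \<in> N' \<Longrightarrow> \<exists>y\<in>N. x \<otimes> inv y \<in> M"
  shows "N' = N"
proof -
  have "x \<in> N" if "x \<in> N'" for x
  proof -
    obtain y where y: "y \<in> N" "x \<otimes> inv y \<in> M" using assms(5)[OF \<open>x \<in> N'\<close>] by blast
    have "x \<otimes> inv y \<in> N" using y assms that by (meson IntI subgroup.m_closed subgroup.m_inv_closed subsetD)
    then have "x \<otimes> inv y \<otimes> y \<in> N" using y assms(1) by (meson subgroup.m_closed)
    moreover have "x \<in> carrier G" "y \<in> carrier G" using that y assms subgroup.mem_carrier by metis+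
    ultimately show ?thesis by (simp add: m_assoc)
  qed
  then show ?thesis using assms(3) by blast
qed

text \<open>A chain of subgroups of \<open>M'\<close> is controlled by the intersections with
  \<open>M\<close> and by the exponents of \<open>c\<close> that occur. The latter form subgroups of
  the integers, so both of these chains become constant.\<close>

lemma noeth_under_cyclic_extension:
  assumes M: "subgroup M G" and c: "c \<in> carrier G"
    and comm: "\<And>a. a \<in> M \<Longrightarrow> c \<otimes> a = a \<otimes> c"
  defines "M' \<equiv> {b \<otimes> c [^] (k::int) | b k. b \<in> M}"
  shows "subgroup M' G" "noeth_under G {} M \<Longrightarrow> noeth_under G {} M'"
proof -
  have Mc: "a \<in> carrier G" if "a \<in> M" for a using that M subgroup.mem_carrier by metis
  have cm: "c [^] (k::int) \<otimes> a = a \<otimes> c [^] k" if "a \<in> M" for a k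
  proof -
    have "a \<otimes> c [^] k = c [^] k \<otimes> a"
      using generate_commute[of a "{c}" "c [^] k"] generate_pow[OF c] Mc[OF that] c comm[OF that] by auto
    then show ?thesis by simp
  qed
  have mul: "(b \<otimes> c [^] k) \<otimes> (b' \<otimes> c [^] l) = (b \<otimes> b') \<otimes> c [^] (k + l)"
    if "b \<in> M" "b' \<in> M" for b b' and k l :: int
  proof -
    have "(b \<otimes> c [^] k) \<otimes> (b' \<otimes> c [^] l) = b \<otimes> (c [^] k \<otimes> b') \<otimes> c [^] l"
      using Mc that c by (simp add: m_assoc)
    also have "\<dots> = (b \<otimes> b') \<otimes> c [^] (k + l)"
      using cm[OF that(2)] Mc that c by (simp add: m_assoc int_pow_mult)
    finally show ?thesis .
  qed
  have iv: "inv (b \<otimes> c [^] k) = inv b \<otimes> c [^] (- k)" if "b \<in> M" for b and k :: int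
  proof -
    have "inv b \<in> M" using that M by (rule subgroup.m_inv_closed[rotated])
    then have "inv (b \<otimes> c [^] k) = c [^] (-k) \<otimes> inv b"
      using Mc that c by (simp add: inv_mult_group int_pow_neg)
    also have "\<dots> = inv b \<otimes> c [^] (- k)" using cm \<open>inv b \<in> M\<close> by simp
    finally show ?thesis .
  qed
  have minv: "inv b \<in> M" if "b \<in> M" for b using that M by (rule subgroup.m_inv_closed[rotated])
  have mmul: "b \<otimes> b' \<in> M" if "b \<in> M" "b' \<in> M" for b b' using that M by (meson subgroup.m_closed)
  have m1: "\<one> \<in> M" using M by (rule subgroup.one_closed)
  show "subgroup M' G"
  proof (rule subgroupI)
    show "M' \<subseteq> carrier G" using Mc c by (auto simp: M'_def)
    have "\<one> \<otimes> c [^] (0::int) \<in> M'" using m1 unfolding M'_def by blast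
    then show "M' \<noteq> {}" by blast
    show "inv a \<in> M'" if "a \<in> M'" for a using that iv minv unfolding M'_def by blast
    show "a \<otimes> b \<in> M'" if "a \<in> M'" "b \<in> M'" for a b
      using that mul mmul unfolding M'_def mem_Collect_eq by metis
  qed
  assume noethM: "noeth_under G {} M"
  show "noeth_under G {} M'"
    unfolding noeth_under_def
  proof (intro allI impI)
    fix N :: "nat \<Rightarrow> 'a set"
    assume N: "\<forall>i. subgroup (N i) G \<and> N i \<subseteq> M' \<and> conj_closed G {} (N i) \<and> N i \<subseteq> N (Suc i)"
    then have sN: "subgroup (N i) G" and NM: "N i \<subseteq> M'" and Ni: "N i \<subseteq> N (Suc i)" for i by auto
    have incr: "N i \<subseteq> N j" if "i \<le> j" for i j
      using that Ni lift_Suc_mono_le[of N] by blast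
    define L where "L i = {k. \<exists>b\<in>M. b \<otimes> c [^] (k::int) \<in> N i}" for i
    obtain n1 where n1: "\<And>k. k \<ge> n1 \<Longrightarrow> L k = L n1"
    proof -
      have "0 \<in> L i" for i
        using sN[of i] m1 c by (auto simp: L_def intro!: bexI[of _ \<one>] subgroup.one_closed)
      moreover have "x - y \<in> L i" if xy: "x \<in> L i" "y \<in> L i" for x y i
      proof -
        obtain b b' where b: "b \<in> M" "b \<otimes> c [^] x \<in> N i" "b' \<in> M" "b' \<otimes> c [^] y \<in> N i"
          using xy unfolding L_def by blast
        then have "(b \<otimes> c [^] x) \<otimes> inv (b' \<otimes> c [^] y) \<in> N i"
          using sN by (meson subgroup.m_closed subgroup.m_inv_closed)
        then have "b \<otimes> inv b' \<otimes> c [^] (x - y) \<in> N i" using iv mul minv b by simp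
        then show ?thesis using b minv mmul unfolding L_def by blast
      qed
      moreover have "L i \<subseteq> L (Suc i)" for i using Ni unfolding L_def by blast
      ultimately show ?thesis using int_subgroup_chain_stable[of L] that by blast
    qed
    obtain n2 where n2: "\<And>k. k \<ge> n2 \<Longrightarrow> N k \<inter> M = N n2 \<inter> M"
    proof -
      have "subgroup (N i \<inter> M) G" for i using sN M by (rule subgroups_Inter_pair)
      then have "\<exists>n. \<forall>k\<ge>n. N k \<inter> M = N n \<inter> M"
        using Ni by (intro noeth_underD[OF noethM]) (auto simp: conj_closed_def)
      then show ?thesis using that by blast
    qed
    have "N k = N (max n1 n2)" if k: "k \<ge> max n1 n2" for k
    proof (rule subset_by_leading_terms[OF sN sN incr[OF k], of M])
      show "N k \<inter> M \<subseteq> N (max n1 n2)" using n2[of k] n2[of "max n1 n2"] k by auto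
      fix x assume x: "x \<in> N k"
      then obtain b l where b: "b \<in> M" "x = b \<otimes> c [^] (l::int)" using NM unfolding M'_def by blast
      then have "l \<in> L (max n1 n2)" using n1[of k] n1[of "max n1 n2"] k x unfolding L_def by auto
      then obtain b' where b': "b' \<in> M" "b' \<otimes> c [^] l \<in> N (max n1 n2)" unfolding L_def by blast
      have "x \<otimes> inv (b' \<otimes> c [^] l) = b \<otimes> inv b'"
        using b b' iv mul minv Mc by simp
      then show "\<exists>y\<in>N (max n1 n2). x \<otimes> inv y \<in> M" using b' b minv mmul by metis
    qed
    then show "\<exists>n. \<forall>k\<ge>n. N k = N n" by blast
  qed
qed

text \<open>Start from the trivial subgroup and adjoin the elements of \<open>F\<close> by cyclic
  extensions. Thus finitely generated abelian groups satisfy the ascending chain condition.\<close>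

lemma noeth_under_finite_subset:
  assumes A: "subgroup A G" "\<And>a b. a \<in> A \<Longrightarrow> b \<in> A \<Longrightarrow> a \<otimes> b = b \<otimes> a"
    and "finite F" "F \<subseteq> A"
  shows "\<exists>M. subgroup M G \<and> F \<subseteq> M \<and> M \<subseteq> A \<and> noeth_under G {} M"
  using assms(3,4)
proof (induction F rule: finite_induct)
  case empty
  have "noeth_under G {} {\<one>}"
    unfolding noeth_under_def
  proof (intro allI impI)
    fix N :: "nat \<Rightarrow> 'a set"
    assume N: "\<forall>i. subgroup (N i) G \<and> N i \<subseteq> {\<one>} \<and> conj_closed G {} (N i) \<and> N i \<subseteq> N (Suc i)"
    then have "N i = {\<one>}" for i using subgroup.one_closed by blast
    then show "\<exists>n. \<forall>k\<ge>n. N k = N n" by simp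
  qed
  then show ?case
    using triv_subgroup subgroup.one_closed[OF A(1)] by (intro exI[of _ "{\<one>}"]) auto
next
  case (insert c F)
  then obtain M where M: "subgroup M G" "F \<subseteq> M" "M \<subseteq> A" "noeth_under G {} M" by auto
  define M' where "M' = {b \<otimes> c [^] (k::int) | b k. b \<in> M}"
  have c: "c \<in> carrier G" "c \<in> A" using insert A(1) subgroup.mem_carrier by auto
  have "subgroup M' G" "noeth_under G {} M'"
    using noeth_under_cyclic_extension[OF M(1) c(1)] M(4) A(2) c M(3) unfolding M'_def by blast+
  moreover have "M' \<subseteq> A"
    unfolding M'_def using M(3) c(2) A(1) subgroup_int_pow_closed subgroup.m_closed[OF A(1)] by blast
  moreover have "insert c F \<subseteq> M'"
  proof -
    have "\<one> \<otimes> c [^] (1::int) \<in> M'" unfolding M'_def using subgroup.one_closed[OF M(1)] by blast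
    moreover have "f \<in> M'" if "f \<in> M" for f
    proof -
      have "f \<otimes> c [^] (0::int) \<in> M'" unfolding M'_def using that by blast
      then show ?thesis using subgroup.mem_carrier[OF M(1) that] by simp
    qed
    ultimately show ?thesis using c M(2) by auto
  qed
  ultimately show ?case by blast
qed

lemma subgroup_by_quotients:
  assumes "H \<subseteq> carrier G" "\<one> \<in> H" "\<And>a b. a \<in> H \<Longrightarrow> b \<in> H \<Longrightarrow> a \<otimes> inv b \<in> H"
  shows "subgroup H G"
proof -
  have i: "inv b \<in> H" if "b \<in> H" for b
    using assms(3)[OF assms(2) that] assms(1) that by auto
  have "a \<otimes> b \<in> H" if "a \<in> H" "b \<in> H" for a b
    using assms(3)[OF that(1) i[OF that(2)]] assms(1) that by auto
  with i assms show ?thesis by (intro subgroupI) auto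
qed

section \<open>Conjugation as a module action\<close>

definition cj :: "'a \<Rightarrow> 'a \<Rightarrow> 'a" where "cj x a = x \<otimes> a \<otimes> inv x"

lemma cj_carrier [simp]: "x \<in> carrier G \<Longrightarrow> a \<in> carrier G \<Longrightarrow> cj x a \<in> carrier G"
  by (simp add: cj_def)

lemma cj_mult: "x \<in> carrier G \<Longrightarrow> a \<in> carrier G \<Longrightarrow> b \<in> carrier G \<Longrightarrow> cj x (a \<otimes> b) = cj x a \<otimes> cj x b"
  by (simp add: cj_def m_assoc inv_solve_left flip: m_assoc) (simp add: m_assoc)

lemma cj_one_right [simp]: "x \<in> carrier G \<Longrightarrow> cj x \<one> = \<one>"
  by (simp add: cj_def)

lemma cj_one_left [simp]: "a \<in> carrier G \<Longrightarrow> cj \<one> a = a"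
  by (simp add: cj_def)

lemma cj_inv: "x \<in> carrier G \<Longrightarrow> a \<in> carrier G \<Longrightarrow> cj x (inv a) = inv (cj x a)"
  by (simp add: cj_def inv_mult_group m_assoc)

lemma cj_comp: "x \<in> carrier G \<Longrightarrow> y \<in> carrier G \<Longrightarrow> a \<in> carrier G \<Longrightarrow> cj (x \<otimes> y) a = cj x (cj y a)"
  by (simp add: cj_def inv_mult_group m_assoc)

end

lemma (in group) conj_closed_iff: "conj_closed G W N \<longleftrightarrow> (\<forall>w\<in>W. \<forall>a\<in>N. cj w a \<in> N)"
  by (simp add: conj_closed_def cj_def)

text \<open>\<open>A\<close> is treated as a module, written multiplicatively, over the integral
  group ring of the abelian group \<open>G Mod A\<close>, which acts by \<open>cj\<close>. Its
  submodules are the normal subgroups of \<open>G\<close> inside \<open>A\<close>.\<close>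

locale abelian_by_abelian = group +
  fixes A
  assumes A_normal: "A \<lhd> G"
    and A_comm: "\<And>a b. a \<in> A \<Longrightarrow> b \<in> A \<Longrightarrow> a \<otimes> b = b \<otimes> a"
    and commutator_in_A: "\<And>x y. x \<in> carrier G \<Longrightarrow> y \<in> carrier G \<Longrightarrow> x \<otimes> y \<otimes> inv x \<otimes> inv y \<in> A"
begin

lemma A_subgroup: "subgroup A G"
  using A_normal by (rule normal_imp_subgroup)

lemma A_carrier [simp]: "a \<in> A \<Longrightarrow> a \<in> carrier G"
  using A_subgroup by (rule subgroup.mem_carrier)

lemma A_one [simp]: "\<one> \<in> A"
  using A_subgroup by (rule subgroup.one_closed)

lemma A_mult [simp]: "a \<in> A \<Longrightarrow> b \<in> A \<Longrightarrow> a \<otimes> b \<in> A"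
  using A_subgroup by (rule subgroup.m_closed)

lemma A_inv [simp]: "a \<in> A \<Longrightarrow> inv a \<in> A"
  using A_subgroup by (rule subgroup.m_inv_closed)

lemma cj_A [simp]: "x \<in> carrier G \<Longrightarrow> a \<in> A \<Longrightarrow> cj x a \<in> A"
  using A_normal unfolding cj_def by (rule normal.inv_op_closed2)

lemma cj_A_A: "a \<in> A \<Longrightarrow> b \<in> A \<Longrightarrow> cj b a = a"
  by (simp add: cj_def A_comm[of b a] m_assoc)

text \<open>The products \<open>x \<otimes> y\<close> and \<open>y \<otimes> x\<close> differ by a
  left factor in \<open>A\<close>, and \<open>A\<close> acts trivially on itself. This commutativity
  of the operators enters the basis theorem and the use of Fitting's lemma.\<close>

lemma cj_commute:
  assumes "x \<in> carrier G" "y \<in> carrier G" "a \<in> A"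
  shows "cj x (cj y a) = cj y (cj x a)"
proof -
  define c where "c = x \<otimes> y \<otimes> inv x \<otimes> inv y"
  have c: "c \<in> A" using assms commutator_in_A unfolding c_def by blast
  have "x \<otimes> y = c \<otimes> (y \<otimes> x)"
    unfolding c_def using assms by (simp add: m_assoc inv_solve_left flip: m_assoc) (simp add: m_assoc)
  then have "cj x (cj y a) = cj c (cj y (cj x a))"
    using assms c by (simp flip: cj_comp)
  also have "\<dots> = cj y (cj x a)" using assms c by (simp add: cj_A_A)
  finally show ?thesis .
qed

lemma A_quotient_mult:
  assumes "a \<in> A" "b \<in> A" "c \<in> A" "d \<in> A"
  shows "(a \<otimes> b) \<otimes> inv (c \<otimes> d) = (a \<otimes> inv c) \<otimes> (b \<otimes> inv d)"
proof -
  have "(a \<otimes> b) \<otimes> inv (c \<otimes> d) = a \<otimes> (b \<otimes> (inv d \<otimes> inv c))"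
    using assms by (simp add: inv_mult_group m_assoc)
  also have "b \<otimes> (inv d \<otimes> inv c) = inv c \<otimes> (b \<otimes> inv d)"
    using assms A_comm[of "b \<otimes> inv d" "inv c"] by (simp add: m_assoc)
  finally show ?thesis using assms by (simp add: m_assoc)
qed

text \<open>Hilbert's basis theorem for modules: an invariant subgroup \<open>N\<close> is controlled by its
  groups \<open>L i k\<close> of leading coefficients at \<open>t^k\<close>.\<close>

lemma noeth_under_insert:
  assumes W: "W \<subseteq> carrier G" and t: "t \<in> carrier G"
    and M0: "subgroup M0 G" "M0 \<subseteq> A" "conj_closed G W M0" "noeth_under G W M0"
  shows "\<exists>M. subgroup M G \<and> M0 \<subseteq> M \<and> M \<subseteq> A \<and> conj_closed G (insert t W) M \<and>
           noeth_under G (insert t W) M"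
proof -
  \<comment> \<open>\<open>T k\<close> is multiplication by \<open>t^k\<close>, and
    \<open>F k\<close> consists of the values of polynomials in \<open>t\<close> of degree less than
    \<open>k\<close> with coefficients in \<open>M0\<close>.\<close>
  define T where "T k a = cj (t [^] (k::nat)) a" for k a
  define F where "F = rec_nat {\<one>} (\<lambda>k B. {b \<otimes> T k a | b a. b \<in> B \<and> a \<in> M0})"
  have F0: "F 0 = {\<one>}" and FS: "F (Suc k) = {b \<otimes> T k a | b a. b \<in> F k \<and> a \<in> M0}" for k
    by (simp_all add: F_def)
  have TA: "T k a \<in> A" if "a \<in> A" for a k using that t by (simp add: T_def)
  have T0: "T 0 a = a" if "a \<in> A" for a using that by (simp add: T_def)
  have TS: "cj t (T k a) = T (Suc k) a" if "a \<in> A" for k a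
    using that t cj_commute[of t "t [^] k" a] by (simp add: T_def cj_comp)
  have Tcj: "cj w (T k a) = T k (cj w a)" if "a \<in> A" "w \<in> carrier G" for w k a
    using that t by (simp add: T_def cj_commute)
  have Tq: "T k (a \<otimes> inv b) = T k a \<otimes> inv (T k b)" if "a \<in> A" "b \<in> A" for k a b
    using that t by (simp add: T_def cj_mult cj_inv)
  have m1: "\<one> \<in> M0" using M0(1) by (rule subgroup.one_closed)
  have mq: "a \<otimes> inv b \<in> M0" if "a \<in> M0" "b \<in> M0" for a b
    using that M0(1) by (meson subgroup.m_closed subgroup.m_inv_closed)
  have mA: "a \<in> A" if "a \<in> M0" for a using that M0 by blast
  have FA: "F k \<subseteq> A" for k
    by (induction k) (use mA TA in \<open>auto simp: F0 FS\<close>)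
  have F1: "\<one> \<in> F k" for k
  proof (induction k)
    case (Suc k)
    have "\<one> \<otimes> T k \<one> \<in> F (Suc k)" using Suc m1 unfolding FS by blast
    then show ?case using t by (simp add: T_def)
  qed (simp add: F0)
  have Fq: "x \<otimes> inv y \<in> F k" if "x \<in> F k" "y \<in> F k" for x y k
    using that
  proof (induction k arbitrary: x y)
    case (Suc k)
    then obtain b a b' a' where h: "x = b \<otimes> T k a" "b \<in> F k" "a \<in> M0" "y = b' \<otimes> T k a'" "b' \<in> F k" "a' \<in> M0"
      unfolding FS by blast
    then have "x \<otimes> inv y = (b \<otimes> inv b') \<otimes> T k (a \<otimes> inv a')"
      using FA mA TA Tq by (simp add: A_quotient_mult subset_iff)
    then show ?case using Suc.IH h mq unfolding FS by blast
  qed (simp add: F0)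
  have Fsub: "subgroup (F k) G" for k
    using F1 Fq by (intro subgroup_by_quotients) (auto dest: subsetD[OF FA])
  have Fincr: "F k \<subseteq> F (Suc k)" for k
  proof
    fix b assume b: "b \<in> F k"
    then have "b \<otimes> T k \<one> \<in> F (Suc k)" using m1 unfolding FS by blast
    then show "b \<in> F (Suc k)" using b subsetD[OF FA b] t by (simp add: T_def)
  qed
  then have Fmono: "F k \<subseteq> F l" if "k \<le> l" for k l
    using that lift_Suc_mono_le[of F] by blast
  have FW: "cj w x \<in> F k" if "x \<in> F k" "w \<in> W" for x w k
    using that(1)
  proof (induction k arbitrary: x)
    case 0 then show ?case using W that by (auto simp: F0)
  next
    case (Suc k)
    then obtain b a where h: "x = b \<otimes> T k a" "b \<in> F k" "a \<in> M0" unfolding FS by blast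
    have w: "w \<in> carrier G" using W that by blast
    have "b \<in> A" "a \<in> A" using h FA mA by auto
    then have "cj w x = cj w b \<otimes> T k (cj w a)"
      using h w Tcj[of a w k] TA[of a k] by (simp add: cj_mult)
    moreover have "cj w a \<in> M0" using M0(3) h that by (simp add: conj_closed_iff)
    ultimately show ?case using Suc.IH h unfolding FS by blast
  qed
  have Ft: "cj t x \<in> F (Suc k)" if "x \<in> F k" for x k
    using that
  proof (induction k arbitrary: x)
    case 0 then show ?case using t F1[of "Suc 0"] by (simp add: F0)
  next
    case (Suc k)
    then obtain b a where h: "x = b \<otimes> T k a" "b \<in> F k" "a \<in> M0" unfolding FS[of k] by blast
    have "b \<in> A" "a \<in> A" using h FA mA by auto
    then have "cj t x = cj t b \<otimes> T (Suc k) a" using h t TA[of a k] TS by (simp add: cj_mult)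
    then show ?case using Suc.IH[OF h(2)] h(3) unfolding FS[of "Suc k"] by blast
  qed
  define M where "M = (\<Union>k. F k)"
  have MA: "M \<subseteq> A" using FA by (auto simp: M_def)
  have "subgroup M G"
  proof (rule subgroup_by_quotients)
    show "M \<subseteq> carrier G" using MA A_carrier by blast
    show "\<one> \<in> M" using F1 by (auto simp: M_def)
    fix a b assume "a \<in> M" "b \<in> M"
    then obtain k l where "a \<in> F k" "b \<in> F l" by (auto simp: M_def)
    then have "a \<in> F (max k l)" "b \<in> F (max k l)" using Fmono by (meson max.cobounded1 max.cobounded2 subsetD)+
    then show "a \<otimes> inv b \<in> M" using Fq by (auto simp: M_def)
  qed
  moreover have "M0 \<subseteq> M"
  proof
    fix a assume a: "a \<in> M0"
    then have "\<one> \<otimes> T 0 a \<in> F (Suc 0)" unfolding FS F0 by blast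
    then show "a \<in> M" using a mA T0 by (auto simp: M_def)
  qed
  moreover have "conj_closed G (insert t W) M"
    using FW Ft unfolding conj_closed_iff M_def by blast
  moreover have "noeth_under G (insert t W) M"
    unfolding noeth_under_def
  proof (intro allI impI)
    fix N :: "nat \<Rightarrow> 'a set"
    assume "\<forall>i. subgroup (N i) G \<and> N i \<subseteq> M \<and> conj_closed G (insert t W) (N i) \<and> N i \<subseteq> N (Suc i)"
    then have sN: "subgroup (N i) G" and NM: "N i \<subseteq> M" and Ncl: "conj_closed G (insert t W) (N i)"
      and Ni: "N i \<subseteq> N (Suc i)" for i by auto
    have Nincr: "N i \<subseteq> N j" if "i \<le> j" for i j
      using that Ni lift_Suc_mono_le[of N] by blast
    have Nq: "a \<otimes> inv b \<in> N i" if "a \<in> N i" "b \<in> N i" for a b i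
      using that sN by (meson subgroup.m_closed subgroup.m_inv_closed)
    \<comment> \<open>The polynomial representing an element need not be unique. So \<open>a\<close>
      counts as a leading coefficient as soon as one representation of an element of
      \<open>N i\<close> ends in \<open>T k a\<close>.\<close>
    define L where "L i k = {a \<in> M0. \<exists>b\<in>F k. b \<otimes> T k a \<in> N i}" for i k
    have LM: "L i k \<subseteq> M0" for i k by (auto simp: L_def)
    have Li: "L i k \<subseteq> L j k" if "i \<le> j" for i j k using Nincr[OF that] by (auto simp: L_def)
    have LSk: "L i k \<subseteq> L i (Suc k)" for i k
    proof
      fix a assume "a \<in> L i k"
      then obtain b where h: "a \<in> M0" "b \<in> F k" "b \<otimes> T k a \<in> N i" by (auto simp: L_def)
      have "b \<in> A" "a \<in> A" using h FA mA by auto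
      then have "cj t (b \<otimes> T k a) = cj t b \<otimes> T (Suc k) a" using t TA[of a k] TS by (simp add: cj_mult)
      moreover have "cj t (b \<otimes> T k a) \<in> N i" using h Ncl by (simp add: conj_closed_iff)
      ultimately show "a \<in> L i (Suc k)" using h Ft[of b k] by (auto simp: L_def)
    qed
    have Lk: "L i k \<subseteq> L i l" if "k \<le> l" for i k l
      using that LSk lift_Suc_mono_le[of "L i"] by blast
    have Lsub: "subgroup (L i k) G" for i k
    proof (rule subgroup_by_quotients)
      show "L i k \<subseteq> carrier G" using LM mA A_carrier by blast
      have "\<one> \<otimes> T k \<one> = \<one>" using t by (simp add: T_def)
      then show "\<one> \<in> L i k" using m1 F1[of k] subgroup.one_closed[OF sN[of i]] by (auto simp: L_def intro!: bexI[of _ \<one>])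
      fix a a' assume "a \<in> L i k" "a' \<in> L i k"
      then obtain b b' where h: "a \<in> M0" "b \<in> F k" "b \<otimes> T k a \<in> N i" "a' \<in> M0" "b' \<in> F k" "b' \<otimes> T k a' \<in> N i"
        by (auto simp: L_def)
      then have "(b \<otimes> T k a) \<otimes> inv (b' \<otimes> T k a') = (b \<otimes> inv b') \<otimes> T k (a \<otimes> inv a')"
        using FA mA TA Tq by (simp add: A_quotient_mult subset_iff)
      then show "a \<otimes> inv a' \<in> L i k"
        using h Nq[of "b \<otimes> T k a" i "b' \<otimes> T k a'"] Fq mq by (auto simp: L_def)
    qed
    have Lcl: "conj_closed G W (L i k)" for i k
      unfolding conj_closed_iff
    proof (intro ballI)
      fix w a assume w: "w \<in> W" and "a \<in> L i k"
      then obtain b where h: "a \<in> M0" "b \<in> F k" "b \<otimes> T k a \<in> N i" by (auto simp: L_def)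
      have wc: "w \<in> carrier G" using W w by blast
      have "b \<in> A" "a \<in> A" using h FA mA by auto
      then have "cj w (b \<otimes> T k a) = cj w b \<otimes> T k (cj w a)"
        using wc Tcj[of a w k] TA[of a k] by (simp add: cj_mult)
      moreover have "cj w (b \<otimes> T k a) \<in> N i" using h w Ncl by (simp add: conj_closed_iff)
      moreover have "cj w a \<in> M0" using M0(3) h w by (simp add: conj_closed_iff)
      ultimately show "cj w a \<in> L i k" using FW[OF h(2) w] by (auto simp: L_def)
    qed
    \<comment> \<open>The groups \<open>L i k\<close> grow in both indices, so it suffices that the
      diagonal and, for each of the finitely many \<open>k < d\<close>, the chain in
      \<open>i\<close> become constant.\<close>
    obtain d where d: "\<And>k. k \<ge> d \<Longrightarrow> L k k = L d d"
    proof -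
      have "L i i \<subseteq> L (Suc i) (Suc i)" for i using LSk[of i i] Li[of i "Suc i" "Suc i"] by simp
      then have "\<exists>n. \<forall>k\<ge>n. L k k = L n n"
        by (rule noeth_underD[OF M0(4), of "\<lambda>k. L k k", rotated -1]) (use Lsub LM Lcl in auto)
      then show ?thesis using that by blast
    qed
    have "\<exists>n. \<forall>i\<ge>n. L i k = L n k" for k
      by (rule noeth_underD[OF M0(4), of "\<lambda>i. L i k"]) (use Lsub LM Lcl Li in auto)
    then obtain e where e: "\<And>k i. i \<ge> e k \<Longrightarrow> L i k = L (e k) k" by metis
    define n where "n = Max (insert d (e ` {..<d}))"
    have nd: "d \<le> n" and ne: "k < d \<Longrightarrow> e k \<le> n" for k by (auto simp: n_def)
    have Leq: "L i k = L n k" if "i \<ge> n" for i k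
    proof (cases "k < d")
      case True
      then show ?thesis using e[of k i] e[of k n] ne[of k] that by simp
    next
      case False
      \<comment> \<open>For \<open>j, k \<ge> d\<close> the group is squeezed between the diagonal
        terms \<open>L d d\<close> and \<open>L (max j k) (max j k)\<close>.\<close>
      have *: "L j k = L d d" if "j \<ge> d" for j
      proof
        have "L j k \<subseteq> L (max j k) (max j k)" using Li Lk by (meson max.cobounded1 max.cobounded2 subset_trans)
        also have "\<dots> = L d d" using that by (intro d) simp
        finally show "L j k \<subseteq> L d d" .
        have "d \<le> k" using False by simp
        then show "L d d \<subseteq> L j k" using Li[OF that, of d] Lk[of d k j] by blast
      qed
      show ?thesis using *[of i] *[of n] that nd by simp
    qed
    have "N i = N n" if i: "i \<ge> n" for i
    proof -
      \<comment> \<open>Induction on the degree: equality of the leading coefficients lets an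
        element of \<open>N n\<close> cancel the top term.\<close>
      have "N i \<inter> F k \<subseteq> N n" for k
      proof (induction k)
        case 0 then show ?case using subgroup.one_closed[OF sN] by (auto simp: F0)
      next
        case (Suc k)
        have "subgroup (N i \<inter> F (Suc k)) G" "subgroup (N n \<inter> F (Suc k)) G"
          using sN Fsub subgroups_Inter_pair by blast+
        moreover have "N i \<inter> F (Suc k) \<inter> F k \<subseteq> N n \<inter> F (Suc k)" using Suc Fincr by blast
        moreover have "\<exists>y\<in>N n \<inter> F (Suc k). x \<otimes> inv y \<in> F k" if "x \<in> N i \<inter> F (Suc k)" for x
        proof -
          obtain b a where h: "x = b \<otimes> T k a" "b \<in> F k" "a \<in> M0" "x \<in> N i"
            using \<open>x \<in> N i \<inter> F (Suc k)\<close> unfolding FS by blast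
          then have "a \<in> L i k" by (auto simp: L_def)
          then have "a \<in> L n k" using Leq[OF i] by simp
          then obtain b' where b': "b' \<in> F k" "b' \<otimes> T k a \<in> N n" by (auto simp: L_def)
          have "x \<otimes> inv (b' \<otimes> T k a) = b \<otimes> inv b'"
            using h b' FA mA TA by (simp add: A_quotient_mult subset_iff)
          then have "x \<otimes> inv (b' \<otimes> T k a) \<in> F k" using Fq h b' by simp
          moreover have "b' \<otimes> T k a \<in> F (Suc k)" using b' h unfolding FS by blast
          ultimately show ?thesis using b' by blast
        qed
        ultimately have "N i \<inter> F (Suc k) = N n \<inter> F (Suc k)"
          using Nincr[OF i] by (intro subset_by_leading_terms[where M = "F k"]) auto
        then show ?case by blast
      qed
      then have "N i \<subseteq> N n" using NM[of i] unfolding M_def by blast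
      then show ?thesis using Nincr[OF i] by blast
    qed
    then show "\<exists>n. \<forall>k\<ge>n. N k = N n" by blast
  qed
  ultimately show ?thesis using MA by blast
qed

text \<open>The basis theorem adjoins the operators one at a time, enlarging the module at each
  step.\<close>

lemma noeth_under_finite_operators:
  assumes "finite W" "W \<subseteq> carrier G" "subgroup M0 G" "M0 \<subseteq> A" "noeth_under G {} M0"
  shows "\<exists>M. subgroup M G \<and> M0 \<subseteq> M \<and> M \<subseteq> A \<and> conj_closed G W M \<and> noeth_under G W M"
  using assms(1,2)
proof (induction W rule: finite_induct)
  case empty
  then show ?case using assms by (intro exI[of _ M0]) (auto simp: conj_closed_def)
next
  case (insert t W)
  then obtain M where "subgroup M G" "M0 \<subseteq> M" "M \<subseteq> A" "conj_closed G W M" "noeth_under G W M" by auto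
  then show ?case using noeth_under_insert[of W t M] insert.prems by (meson insert_subset subset_trans)
qed

end

section \<open>Quotients and the chain condition in the derived subgroup\<close>

lemma noeth_under_mono: "noeth_under G W M \<Longrightarrow> W \<subseteq> W' \<Longrightarrow> noeth_under G W' M"
  unfolding noeth_under_def conj_closed_def by (meson subset_iff)

lemma (in group) commutator_eq_one_iff:
  assumes "x \<in> carrier G" "y \<in> carrier G"
  shows "x \<otimes> y \<otimes> inv x \<otimes> inv y = \<one> \<longleftrightarrow> x \<otimes> y = y \<otimes> x"
proof -
  have "x \<otimes> y \<otimes> inv x \<otimes> inv y = (x \<otimes> y) \<otimes> inv (y \<otimes> x)"
    using assms by (simp add: inv_mult_group m_assoc)
  then show ?thesis
    using assms inv_solve_right'[of \<one> "x \<otimes> y" "y \<otimes> x"] by auto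
qed

lemma (in group) conj_closed_normal:
  assumes "subgroup N G" "conj_closed G (carrier G) N"
  shows "N \<lhd> G"
  using assms by (intro normal_invI) (auto simp: conj_closed_def)

lemma (in normal) coset_group_hom: "group_hom G (G Mod H) (\<lambda>a. H #> a)"
  by (simp add: group_hom_def group_hom_axioms_def factorgroup_is_group r_coset_hom_Mod is_group)

lemma (in normal) coset_eq_self_iff: "x \<in> carrier G \<Longrightarrow> H #> x = H \<longleftrightarrow> x \<in> H"
  using coset_join1 coset_join2 is_subgroup subset by blast

lemma (in normal) coset_commute_iff:
  assumes "x \<in> carrier G" "y \<in> carrier G"
  shows "(H #> x) \<otimes>\<^bsub>G Mod H\<^esub> (H #> y) = (H #> y) \<otimes>\<^bsub>G Mod H\<^esub> (H #> x) \<longleftrightarrow>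
    x \<otimes> y \<otimes> inv x \<otimes> inv y \<in> H"
proof -
  interpret h: group_hom G "G Mod H" "\<lambda>a. H #> a" by (rule coset_group_hom)
  let ?u = "H #> x" and ?v = "H #> y"
  have "H #> (x \<otimes> y \<otimes> inv x \<otimes> inv y) =
      ?u \<otimes>\<^bsub>G Mod H\<^esub> ?v \<otimes>\<^bsub>G Mod H\<^esub> inv\<^bsub>G Mod H\<^esub> ?u \<otimes>\<^bsub>G Mod H\<^esub> inv\<^bsub>G Mod H\<^esub> ?v"
    using assms by (simp only: h.hom_mult h.hom_inv m_closed inv_closed)
  moreover have "H #> (x \<otimes> y \<otimes> inv x \<otimes> inv y) = \<one>\<^bsub>G Mod H\<^esub> \<longleftrightarrow> x \<otimes> y \<otimes> inv x \<otimes> inv y \<in> H"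
    unfolding one_FactGroup using assms by (intro coset_eq_self_iff) simp
  ultimately show ?thesis
    using h.H.commutator_eq_one_iff[OF h.hom_closed[OF assms(1)] h.hom_closed[OF assms(2)]]
    by (simp only:)
qed

lemma (in group) commutator_in_derived:
  "x \<in> H \<Longrightarrow> y \<in> H \<Longrightarrow> x \<otimes> y \<otimes> inv x \<otimes> inv y \<in> derived G H"
  unfolding derived_def by (rule generate.incl) blast

lemma (in group) comm_group_if_generators_commute:
  assumes "S \<subseteq> carrier G" "generate G S = carrier G"
    "\<And>s t. s \<in> S \<Longrightarrow> t \<in> S \<Longrightarrow> s \<otimes> t = t \<otimes> s"
  shows "comm_group G"
  using generate_commute_generate[OF assms(1,1,3)] assms(2) by (intro group_comm_groupI) auto

lemma (in group) metabelian_abelian_by_abelian: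
  assumes "derived G (derived G (carrier G)) = {\<one>}"
  shows "abelian_by_abelian G (derived G (carrier G))"
proof (intro abelian_by_abelian.intro abelian_by_abelian_axioms.intro is_group)
  have D: "derived G (carrier G) \<subseteq> carrier G" by (rule derived_in_carrier) simp
  show "derived G (carrier G) \<lhd> G" by (rule derived_self_is_normal)
  show "x \<otimes> y \<otimes> inv x \<otimes> inv y \<in> derived G (carrier G)" if "x \<in> carrier G" "y \<in> carrier G" for x y
    using that by (rule commutator_in_derived)
  show "a \<otimes> b = b \<otimes> a" if "a \<in> derived G (carrier G)" "b \<in> derived G (carrier G)" for a b
    using commutator_in_derived[OF that] assms D that commutator_eq_one_iff[of a b] by auto
qed

text \<open>P. Hall's theorem: under conjugation the derived subgroup is finitely generated, namely by the
  commutators of the generators.\<close>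

lemma (in group) metabelian_noeth_under:
  assumes S: "finite S" "S \<subseteq> carrier G" "generate G S = carrier G"
    and metab: "derived G (derived G (carrier G)) = {\<one>}"
  shows "noeth_under G (carrier G) (derived G (carrier G))"
proof -
  define A where "A = derived G (carrier G)"
  interpret abelian_by_abelian G A
    using metabelian_abelian_by_abelian[OF metab] by (simp add: A_def)
  define F where "F = (\<lambda>(s, t). s \<otimes> t \<otimes> inv s \<otimes> inv t) ` (S \<times> S)"
  have "finite F" using S by (simp add: F_def)
  moreover have "F \<subseteq> A" by (auto simp: F_def intro!: commutator_in_A subsetD[OF S(2)])
  ultimately obtain M0 where M0: "subgroup M0 G" "F \<subseteq> M0" "M0 \<subseteq> A" "noeth_under G {} M0"
    using noeth_under_finite_subset[OF A_subgroup A_comm] by blast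
  \<comment> \<open>Inverses are included because invariance under \<open>S\<close> alone need not
    pass to the inverses of the generators.\<close>
  define W where "W = S \<union> m_inv G ` S"
  have W: "finite W" "W \<subseteq> carrier G" using S by (auto simp: W_def)
  obtain M where M: "subgroup M G" "M0 \<subseteq> M" "M \<subseteq> A" "conj_closed G W M" "noeth_under G W M"
    using noeth_under_finite_operators[OF W M0(1,3,4)] by blast
  have "\<forall>a\<in>M. cj g a \<in> M" if "g \<in> generate G S" for g
    using that
  proof (induction rule: generate.induct)
    case one
    then show ?case using M(1) subgroup.mem_carrier by (metis cj_one_left)
  next
    case (incl h)
    then show ?case using M(4) by (auto simp: conj_closed_iff W_def)
  next
    case (inv h)
    then show ?case using M(4) by (auto simp: conj_closed_iff W_def)
  next
    case (eng h1 h2)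
    then have "h1 \<in> carrier G" "h2 \<in> carrier G" using S(3) by auto
    then show ?case using eng M(1) by (auto simp: cj_comp subgroup.mem_carrier)
  qed
  then have "conj_closed G (carrier G) M" using S(3) by (auto simp: conj_closed_iff)
  then have Mn: "M \<lhd> G" by (rule conj_closed_normal[OF M(1)])
  then interpret M: normal M G .
  interpret Q: group "G Mod M" by (rule M.factorgroup_is_group)
  interpret h: group_hom G "G Mod M" "\<lambda>a. M #> a" by (rule M.coset_group_hom)
  \<comment> \<open>\<open>M\<close> contains the commutators of the generators, so the generators
    of \<open>G Mod M\<close> commute, and the minimality of the derived subgroup yields
    \<open>A \<subseteq> M\<close>.\<close>
  have "comm_group (G Mod M)"
  proof (rule Q.comm_group_if_generators_commute)
    show "(\<lambda>a. M #> a) ` S \<subseteq> carrier (G Mod M)" using S by auto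
    show "generate (G Mod M) ((\<lambda>a. M #> a) ` S) = carrier (G Mod M)"
      using h.generate_img[OF S(2)] S(3) by (simp add: carrier_FactGroup)
    fix a b assume "a \<in> (\<lambda>a. M #> a) ` S" "b \<in> (\<lambda>a. M #> a) ` S"
    then obtain s t where st: "s \<in> S" "t \<in> S" "a = M #> s" "b = M #> t" by blast
    have c: "s \<in> carrier G" "t \<in> carrier G" using st S by auto
    have "s \<otimes> t \<otimes> inv s \<otimes> inv t \<in> M" using st M0(2) M(2) by (force simp: F_def)
    then show "a \<otimes>\<^bsub>G Mod M\<^esub> b = b \<otimes>\<^bsub>G Mod M\<^esub> a"
      unfolding st using c by (simp only: M.coset_commute_iff)
  qed
  then have "A \<subseteq> M" using derived_minimal[OF Mn] by (simp add: A_def)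
  then have "M = A" using M(3) by blast
  \<comment> \<open>The chain condition passes to a larger set of operators, which creates no new
    invariant subgroups.\<close>
  then show ?thesis using M(5) W(2) noeth_under_mono unfolding A_def by blast
qed

section \<open>Relations among more elements than generators\<close>

lemma (in comm_group) generate_insert_decomp:
  assumes "g \<in> carrier G" "S \<subseteq> carrier G" "x \<in> generate G (insert g S)"
  shows "\<exists>k::int. \<exists>b\<in>generate G S. x = b \<otimes> g [^] k"
proof -
  define M where "M = {b \<otimes> g [^] (k::int) | b k. b \<in> generate G S}"
  have sub: "subgroup (generate G S) G" by (rule generate_is_subgroup[OF assms(2)])
  have c: "b \<in> carrier G" if "b \<in> generate G S" for b using generate_in_carrier[OF assms(2) that] .
  have "subgroup M G"
    unfolding M_def by (rule noeth_under_cyclic_extension(1)[OF sub assms(1)]) (use m_comm assms c in auto)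
  moreover have "insert g S \<subseteq> M"
  proof -
    have "\<one> \<otimes> g [^] (1::int) \<in> M" unfolding M_def using generate.one by blast
    moreover have "s \<otimes> g [^] (0::int) \<in> M" if "s \<in> S" for s unfolding M_def using generate.incl that by fast
    ultimately show ?thesis using assms by (auto simp: subset_iff)
  qed
  ultimately have "x \<in> M" using generate_subgroup_incl assms(3) by blast
  then show ?thesis unfolding M_def by blast
qed

text \<open>Dividing by the smallest \<open>p\<close>-adic valuation keeps the exponent of the eliminated
  relation prime to \<open>p\<close>.\<close>

lemma (in comm_group) power_in_generate_others:
  fixes p :: int
  assumes "finite S" "S \<subseteq> carrier G" "finite I" "card S < card I"
    "\<And>i. i \<in> I \<Longrightarrow> x i \<in> generate G S" and prime_p: "Factorial_Ring.prime p"
  shows "\<exists>i\<in>I. \<exists>n::int. \<not> p dvd n \<and> x i [^] n \<in> generate G (x ` (I - {i}))"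
  using assms(1-5)
proof (induction S arbitrary: I x rule: finite_induct)
  case empty
  then obtain i where i: "i \<in> I" by fastforce
  have "x i [^] (1::int) = \<one>" using empty.prems i by (simp add: generate_empty)
  then have "x i [^] (1::int) \<in> generate G (x ` (I - {i}))" by (simp only: generate.one)
  moreover have "\<not> p dvd 1" using prime_p not_prime_unit by blast
  ultimately show ?case using i by blast
next
  case (insert g S)
  have gS: "g \<in> carrier G" "S \<subseteq> carrier G" using insert.prems by auto
  have xc: "x i \<in> carrier G" if "i \<in> I" for i
    using generate_in_carrier[OF insert.prems(1)] insert.prems(4) that by blast
  have "\<forall>i\<in>I. \<exists>k. \<exists>b. b \<in> generate G S \<and> x i = b \<otimes> g [^] (k::int)"
    using generate_insert_decomp[OF gS] insert.prems(4) by blast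
  then obtain v s where vs: "\<And>i. i \<in> I \<Longrightarrow> s i \<in> generate G S \<and> x i = s i \<otimes> g [^] (v i :: int)"
    by metis
  have sc: "s i \<in> carrier G" if "i \<in> I" for i
    using generate_in_carrier[OF gS(2)] vs that by blast
  show ?case
  proof (cases "\<forall>i\<in>I. v i = 0")
    case True
    obtain i1 where i1: "i1 \<in> I" using insert.prems(3) by fastforce
    have "\<exists>i\<in>I-{i1}. \<exists>n. \<not> p dvd n \<and> x i [^] n \<in> generate G (x ` (I - {i1} - {i}))"
    proof (rule insert.IH)
      show "card S < card (I - {i1})" using insert i1 by (simp add: card_Diff_singleton)
      show "x i \<in> generate G S" if "i \<in> I - {i1}" for i using vs[of i] sc[of i] True that by simp
    qed (use gS insert in auto)
    then obtain i n where "i \<in> I" "\<not> p dvd n" "x i [^] n \<in> generate G (x ` (I - {i1} - {i}))" by blast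
    moreover have "generate G (x ` (I - {i1} - {i})) \<subseteq> generate G (x ` (I - {i}))"
      by (rule mono_generate) blast
    ultimately show ?thesis by blast
  next
    case False
    \<comment> \<open>Zero exponents are left out because \<open>multiplicity p 0\<close> is 0 and
      could spoil the minimisation.\<close>
    define J where "J = {i \<in> I. v i \<noteq> 0}"
    obtain i0 where i0: "is_arg_min (\<lambda>i. multiplicity p (v i)) (\<lambda>i. i \<in> J) i0"
      using ex_is_arg_min_if_finite[of J "\<lambda>i. multiplicity p (v i)"] False insert.prems(2)
      by (auto simp: J_def)
    then have i0J: "i0 \<in> I" "v i0 \<noteq> 0" by (auto simp: is_arg_min_def J_def)
    define k where "k = multiplicity p (v i0)"
    have pu: "\<not> is_unit p" using prime_p not_prime_unit by blast
    obtain u where u: "v i0 = p ^ k * u" "\<not> p dvd u"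
      using multiplicity_decompose'[OF i0J(2) pu] unfolding k_def by blast
    have "p ^ k dvd v i" if "i \<in> I" for i
    proof (cases "v i = 0")
      case False
      then have "k \<le> multiplicity p (v i)"
        using i0 that unfolding k_def is_arg_min_def J_def by (metis (mono_tags, lifting) mem_Collect_eq not_le)
      then show ?thesis by (simp add: multiplicity_dvd')
    qed simp
    then have "\<forall>i\<in>I. \<exists>w. v i = p ^ k * w" by (auto simp: dvd_def)
    then obtain w where w: "\<And>i. i \<in> I \<Longrightarrow> v i = p ^ k * w i" by metis
    \<comment> \<open>The exponent of \<open>g\<close> in \<open>x' i\<close> is
      \<open>v i * u - v i0 * w i = 0\<close>, so the \<open>x' i\<close> lie in the group generated
      by \<open>S\<close>, and the induction hypothesis applies to the indices other than
      \<open>i0\<close>.\<close>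
    define x' where "x' i = x i [^] u \<otimes> x i0 [^] (- w i)" for i
    have subS: "subgroup (generate G S) G" by (rule generate_is_subgroup[OF gS(2)])
    have x'S: "x' i \<in> generate G S" if i: "i \<in> I" for i
    proof -
      have "x' i = (s i [^] u \<otimes> g [^] (v i * u)) \<otimes> (s i0 [^] (- w i) \<otimes> g [^] (v i0 * (- w i)))"
        using vs[OF i] vs[OF i0J(1)] sc[OF i] sc[OF i0J(1)] gS
        unfolding x'_def by (simp add: int_pow_distrib int_pow_pow)
      also have "\<dots> = (s i [^] u \<otimes> s i0 [^] (- w i)) \<otimes> (g [^] (v i * u) \<otimes> g [^] (v i0 * (- w i)))"
        using sc[OF i] sc[OF i0J(1)] gS by (simp add: m_ac)
      also have "g [^] (v i * u) \<otimes> g [^] (v i0 * (- w i)) = g [^] (v i * u + v i0 * (- w i))"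
        using gS by (simp only: int_pow_mult)
      also have "v i * u + v i0 * (- w i) = 0" using w[OF i] u(1) by simp
      finally have "x' i = s i [^] u \<otimes> s i0 [^] (- w i)" using sc[OF i] sc[OF i0J(1)] by simp
      then show ?thesis
        using subgroup.m_closed[OF subS] subgroup_int_pow_closed[OF subS] vs[OF i] vs[OF i0J(1)] by metis
    qed
    have "\<exists>i\<in>I-{i0}. \<exists>n. \<not> p dvd n \<and> x' i [^] n \<in> generate G (x' ` (I - {i0} - {i}))"
    proof (rule insert.IH)
      show "card S < card (I - {i0})" using insert i0J by (simp add: card_Diff_singleton)
    qed (use gS insert x'S in auto)
    then obtain i n where i: "i \<in> I" "i \<noteq> i0" and n: "\<not> p dvd n"
      and xin: "x' i [^] n \<in> generate G (x' ` (I - {i0} - {i}))" by blast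
    define H where "H = generate G (x ` (I - {i}))"
    have subH: "subgroup H G" unfolding H_def by (rule generate_is_subgroup) (use xc in auto)
    have xH: "x j \<in> H" if "j \<in> I" "j \<noteq> i" for j
      unfolding H_def using that by (intro generate.incl) auto
    have "x' ` (I - {i0} - {i}) \<subseteq> H"
      using xH i0J i subgroup.m_closed[OF subH] subgroup_int_pow_closed[OF subH] by (auto simp: x'_def)
    then have "x' i [^] n \<in> H" using xin generate_subgroup_incl[OF _ subH] by blast
    moreover have "x i0 [^] (w i * n) \<in> H" using xH[of i0] i0J i subgroup_int_pow_closed[OF subH] by metis
    ultimately have "x' i [^] n \<otimes> x i0 [^] (w i * n) \<in> H" by (rule subgroup.m_closed[OF subH])
    \<comment> \<open>Cancelling the power of \<open>x i0\<close> turns the relation for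
      \<open>x' i\<close> into one for \<open>x i\<close>, whose exponent \<open>u * n\<close> is
      still prime to \<open>p\<close>.\<close>
    moreover have "x' i [^] n \<otimes> x i0 [^] (w i * n) = x i [^] (u * n)"
    proof -
      have "x' i [^] n \<otimes> x i0 [^] (w i * n) = x i [^] (u * n) \<otimes> (x i0 [^] (- w i * n) \<otimes> x i0 [^] (w i * n))"
        using xc[OF i(1)] xc[OF i0J(1)] unfolding x'_def by (simp add: int_pow_distrib int_pow_pow m_assoc)
      also have "x i0 [^] (- w i * n) \<otimes> x i0 [^] (w i * n) = \<one>"
        using xc[OF i0J(1)] by (simp flip: int_pow_mult)
      finally show ?thesis using xc[OF i(1)] by simp
    qed
    moreover have "\<not> p dvd u * n" using u(2) n prime_p prime_dvd_mult_iff by blast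
    ultimately show ?thesis using i(1) unfolding H_def by metis
  qed
qed

context abelian_by_abelian
begin

text \<open>Apply the preceding lemma to the images in the abelian group \<open>G Mod A\<close>,
  which is generated by at most \<open>card S\<close> elements, and lift the relation back to
  \<open>G\<close>.\<close>

lemma power_product_in_A:
  fixes p :: nat
  assumes S: "finite S" "S \<subseteq> carrier G" "generate G S = carrier G"
    and I: "finite I" "card S < card I" "\<And>i. i \<in> I \<Longrightarrow> x i \<in> carrier G" and p: "Factorial_Ring.prime p"
  shows "\<exists>i\<in>I. \<exists>n::nat. \<not> p dvd n \<and> (\<exists>c\<in>generate G (x ` (I - {i})). x i [^] n \<otimes> c \<in> A)"
proof -
  interpret A: normal A G by (rule A_normal)
  interpret Q: group "G Mod A" by (rule A.factorgroup_is_group)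
  interpret h: group_hom G "G Mod A" "\<lambda>a. A #> a" by (rule A.coset_group_hom)
  have "comm_group (G Mod A)"
  proof (rule Q.group_comm_groupI)
    fix U V assume "U \<in> carrier (G Mod A)" "V \<in> carrier (G Mod A)"
    then obtain s t where st: "s \<in> carrier G" "t \<in> carrier G" "U = A #> s" "V = A #> t"
      by (auto simp: carrier_FactGroup)
    then show "U \<otimes>\<^bsub>G Mod A\<^esub> V = V \<otimes>\<^bsub>G Mod A\<^esub> U"
      using commutator_in_A[of s t] by (simp only: A.coset_commute_iff)
  qed
  then interpret Q: comm_group "G Mod A" .
  define S' where "S' = (\<lambda>a. A #> a) ` S"
  have S'fin: "finite S'" using S(1) by (simp add: S'_def)
  have S'c: "S' \<subseteq> carrier (G Mod A)" using S(2) by (auto simp: S'_def carrier_FactGroup)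
  define U where "U i = A #> x i" for i
  have "generate (G Mod A) S' = carrier (G Mod A)"
    using h.generate_img[OF S(2)] S(3) by (simp add: carrier_FactGroup S'_def)
  moreover have "U i \<in> carrier (G Mod A)" if "i \<in> I" for i using I(3)[OF that] by (simp add: U_def)
  moreover have "card S' < card I" using I(2) card_image_le[OF S(1)] unfolding S'_def by (metis le_less_trans)
  ultimately obtain i n where i: "i \<in> I" "\<not> int p dvd n" "U i [^]\<^bsub>G Mod A\<^esub> n \<in> generate (G Mod A) (U ` (I - {i}))"
    using Q.power_in_generate_others[of S' I U "int p"] S'c S'fin I(1) p by auto
  define T where "T = x ` (I - {i})"
  have T: "T \<subseteq> carrier G" using I(3) by (auto simp: T_def)
  have UT: "U ` (I - {i}) = (\<lambda>a. A #> a) ` T" by (auto simp: U_def T_def)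
  \<comment> \<open>The exponent \<open>n\<close> may be negative; inverting the relation replaces
    it by its absolute value.\<close>
  define V where "V = U i [^]\<^bsub>G Mod A\<^esub> (int (nat \<bar>n\<bar>))"
  have "V \<in> generate (G Mod A) (U ` (I - {i}))"
  proof (cases "n \<ge> 0")
    case True then show ?thesis using i by (simp add: V_def)
  next
    case False
    then have "V = inv\<^bsub>G Mod A\<^esub> (U i [^]\<^bsub>G Mod A\<^esub> n)"
      using I(3)[OF i(1)] by (simp add: V_def U_def Q.int_pow_neg)
    then show ?thesis using i(3) Q.generate_m_inv_closed h.hom_closed T unfolding UT by (metis image_subset_iff subset_iff)
  qed
  then obtain c where c: "c \<in> generate G T" "V = A #> c"
    using h.generate_img[OF T] unfolding UT by (metis imageE)
  have cc: "c \<in> carrier G" using generate_in_carrier[OF T c(1)] .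
  have "A #> (x i [^] nat \<bar>n\<bar> \<otimes> inv c) = \<one>\<^bsub>G Mod A\<^esub>"
  proof -
    have "A #> (x i [^] nat \<bar>n\<bar>) = V"
      using I(3)[OF i(1)] unfolding V_def U_def int_pow_int by (simp only: A.FactGroup_pow)
    then show ?thesis using c cc I(3)[OF i(1)] by (simp only: h.hom_mult h.hom_inv inv_closed nat_pow_closed Q.r_inv h.hom_closed)
  qed
  then have "x i [^] nat \<bar>n\<bar> \<otimes> inv c \<in> A"
    unfolding one_FactGroup using I(3)[OF i(1)] cc by (subst (asm) A.coset_eq_self_iff) simp_all
  moreover have "inv c \<in> generate G T" using generate_m_inv_closed[OF T c(1)] .
  moreover have "\<not> p dvd nat \<bar>n\<bar>" using i(2) by (simp add: int_dvd_int_iff[symmetric])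
  ultimately show ?thesis using i(1) unfolding T_def by blast
qed

end

subsection \<open>Separated families of pairs\<close>

text \<open>The index type is free because a large family is later arranged as a grid of pairs. The
  clause for \<open>x\<close> and \<open>y\<close>, read with \<open>i\<close> and \<open>j\<close>
  exchanged, also makes \<open>y i\<close> commute with \<open>x j\<close>.\<close>

definition separated_family ::
  "('a, 'b) monoid_scheme \<Rightarrow> 'i set \<Rightarrow> ('i \<Rightarrow> 'a) \<Rightarrow> ('i \<Rightarrow> 'a) \<Rightarrow> bool" where
  "separated_family G I x y \<longleftrightarrow>
    (\<forall>i\<in>I. x i \<in> carrier G \<and> y i \<in> carrier G \<and> x i \<otimes>\<^bsub>G\<^esub> y i \<noteq> y i \<otimes>\<^bsub>G\<^esub> x i) \<and>
    (\<forall>i\<in>I. \<forall>j\<in>I. i \<noteq> j \<longrightarrow>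
       x i \<otimes>\<^bsub>G\<^esub> x j = x j \<otimes>\<^bsub>G\<^esub> x i \<and> x i \<otimes>\<^bsub>G\<^esub> y j = y j \<otimes>\<^bsub>G\<^esub> x i \<and>
       y i \<otimes>\<^bsub>G\<^esub> y j = y j \<otimes>\<^bsub>G\<^esub> y i)"

text \<open>A definition cannot quantify over index types, so the bound ranges over sets of natural
  numbers; grids are reached by \<open>separated_family_reindex\<close>.\<close>

definition separation_bounded :: "('a, 'b) monoid_scheme \<Rightarrow> bool" where
  "separation_bounded G \<longleftrightarrow>
    (\<exists>m. \<forall>(I :: nat set) x y. finite I \<longrightarrow> separated_family G I x y \<longrightarrow> card I \<le> m)"

lemma separated_family_subset:
  "separated_family G I x y \<Longrightarrow> J \<subseteq> I \<Longrightarrow> separated_family G J x y"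
  unfolding separated_family_def by blast

lemma separated_family_reindex:
  assumes "separated_family G (f ` J) x y" "inj_on f J"
  shows "separated_family G J (x \<circ> f) (y \<circ> f)"
  using assms(1) unfolding separated_family_def by (auto simp: inj_on_eq_iff[OF assms(2)])

lemma separated_family_hom_image:
  assumes h: "h \<in> hom G H" and fam: "separated_family G I x y"
    and nc: "\<And>i. i \<in> I \<Longrightarrow> h (x i) \<otimes>\<^bsub>H\<^esub> h (y i) \<noteq> h (y i) \<otimes>\<^bsub>H\<^esub> h (x i)"
  shows "separated_family H I (h \<circ> x) (h \<circ> y)"
proof -
  have "h a \<otimes>\<^bsub>H\<^esub> h b = h b \<otimes>\<^bsub>H\<^esub> h a"
    if "a \<in> carrier G" "b \<in> carrier G" "a \<otimes>\<^bsub>G\<^esub> b = b \<otimes>\<^bsub>G\<^esub> a" for a b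
    using that h by (metis hom_mult)
  moreover have "h a \<in> carrier H" if "a \<in> carrier G" for a
    using that h by (rule hom_in_carrier[rotated])
  ultimately show ?thesis using fam nc unfolding separated_family_def comp_def by metis
qed

text \<open>The kernels meet trivially, so the commutator of each pair survives in \<open>H1\<close>
  or in \<open>H2\<close>. The indices are thus covered by two sets of at most \<open>m1\<close> and
  \<open>m2\<close> elements.\<close>

lemma separation_bounded_of_homs:
  assumes "group G" "group H1" "group H2"
    and h: "h1 \<in> hom G H1" "h2 \<in> hom G H2"
    and bd: "separation_bounded H1" "separation_bounded H2"
    and ker: "\<And>g. g \<in> carrier G \<Longrightarrow> h1 g = \<one>\<^bsub>H1\<^esub> \<Longrightarrow> h2 g = \<one>\<^bsub>H2\<^esub> \<Longrightarrow> g = \<one>\<^bsub>G\<^esub>"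
  shows "separation_bounded G"
proof -
  interpret G: group G by fact
  interpret h1: group_hom G H1 h1 using assms by (simp add: group_hom_def group_hom_axioms_def)
  interpret h2: group_hom G H2 h2 using assms by (simp add: group_hom_def group_hom_axioms_def)
  obtain m1 where m1: "\<And>(I :: nat set) x y. finite I \<Longrightarrow> separated_family H1 I x y \<Longrightarrow> card I \<le> m1"
    using bd(1) unfolding separation_bounded_def by blast
  obtain m2 where m2: "\<And>(I :: nat set) x y. finite I \<Longrightarrow> separated_family H2 I x y \<Longrightarrow> card I \<le> m2"
    using bd(2) unfolding separation_bounded_def by blast
  have "card I \<le> m1 + m2" if fin: "finite I" and fam: "separated_family G I x y" for I :: "nat set" and x y
  proof -
    define I1 where "I1 = {i \<in> I. h1 (x i) \<otimes>\<^bsub>H1\<^esub> h1 (y i) \<noteq> h1 (y i) \<otimes>\<^bsub>H1\<^esub> h1 (x i)}"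
    define I2 where "I2 = {i \<in> I. h2 (x i) \<otimes>\<^bsub>H2\<^esub> h2 (y i) \<noteq> h2 (y i) \<otimes>\<^bsub>H2\<^esub> h2 (x i)}"
    have "separated_family H1 I1 (h1 \<circ> x) (h1 \<circ> y)"
      by (rule separated_family_hom_image[OF h(1) separated_family_subset[OF fam]]) (auto simp: I1_def)
    then have c1: "card I1 \<le> m1" using fin by (intro m1) (auto simp: I1_def)
    have "separated_family H2 I2 (h2 \<circ> x) (h2 \<circ> y)"
      by (rule separated_family_hom_image[OF h(2) separated_family_subset[OF fam]]) (auto simp: I2_def)
    then have c2: "card I2 \<le> m2" using fin by (intro m2) (auto simp: I2_def)
    have "I \<subseteq> I1 \<union> I2"
    proof (rule subsetI, rule ccontr)
      fix i assume i: "i \<in> I" "i \<notin> I1 \<union> I2"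
      have c: "x i \<in> carrier G" "y i \<in> carrier G" and nc: "x i \<otimes>\<^bsub>G\<^esub> y i \<noteq> y i \<otimes>\<^bsub>G\<^esub> x i"
        using fam i(1) by (auto simp: separated_family_def)
      define z where "z = x i \<otimes>\<^bsub>G\<^esub> y i \<otimes>\<^bsub>G\<^esub> inv\<^bsub>G\<^esub> (x i) \<otimes>\<^bsub>G\<^esub> inv\<^bsub>G\<^esub> (y i)"
      have "h1 z = \<one>\<^bsub>H1\<^esub>"
        using h1.H.commutator_eq_one_iff[of "h1 (x i)" "h1 (y i)"] i c by (simp add: z_def I1_def)
      moreover have "h2 z = \<one>\<^bsub>H2\<^esub>"
        using h2.H.commutator_eq_one_iff[of "h2 (x i)" "h2 (y i)"] i c by (simp add: z_def I2_def)
      ultimately have "z = \<one>\<^bsub>G\<^esub>" using ker[of z] c by (simp add: z_def)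
      then show False using nc c G.commutator_eq_one_iff[of "x i" "y i"] by (simp add: z_def)
    qed
    then have "card I \<le> card (I1 \<union> I2)" using fin by (intro card_mono) (auto simp: I1_def I2_def)
    also have "\<dots> \<le> card I1 + card I2" by (rule card_Un_le)
    finally show ?thesis using c1 c2 by simp
  qed
  then show ?thesis unfolding separation_bounded_def by blast
qed

lemma separation_bounded_inj_hom:
  assumes "group G" "group H" "h \<in> hom G H" "inj_on h (carrier G)" "separation_bounded H"
  shows "separation_bounded G"
proof (rule separation_bounded_of_homs[OF assms(1,2,2,3,3,5,5)])
  fix g assume "g \<in> carrier G" "h g = \<one>\<^bsub>H\<^esub>"
  moreover have "h \<one>\<^bsub>G\<^esub> = \<one>\<^bsub>H\<^esub>" using assms(1-3) by (intro hom_one)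
  moreover have "\<one>\<^bsub>G\<^esub> \<in> carrier G" using assms(1) by (simp add: group.is_monoid)
  ultimately show "g = \<one>\<^bsub>G\<^esub>" using assms(4) by (metis inj_onD)
qed

section \<open>Unipotent action on a meet-irreducible module\<close>

context group
begin

lemma nat_pow_commute:
  assumes "x \<in> carrier G" "z \<in> carrier G" "x \<otimes> z = z \<otimes> x"
  shows "x [^] (n::nat) \<otimes> z = z \<otimes> x [^] n"
proof (induction n)
  case (Suc n)
  then show ?case using assms by (simp add: m_assoc) (metis assms m_assoc nat_pow_closed)
qed (use assms in simp)

lemma cj_fixed_iff: "x \<in> carrier G \<Longrightarrow> z \<in> carrier G \<Longrightarrow> cj x z = z \<longleftrightarrow> x \<otimes> z = z \<otimes> x"
  unfolding cj_def by (metis inv_solve_right' m_closed)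

lemma eq_one_if_coprime_powers:
  assumes "a \<in> carrier G" "a [^] (m::nat) = \<one>" "a [^] (n::nat) = \<one>" "Rings.coprime m n"
  shows "a = \<one>"
proof -
  have "ord a dvd m" "ord a dvd n" using assms pow_eq_id by auto
  then have "ord a = 1" using assms(4) by (meson coprime_common_divisor_nat)
  then show ?thesis using assms(1) ord_eq_1 by blast
qed

end

context abelian_by_abelian
begin

text \<open>Fitting's lemma: in the meet-irreducible module \<open>A\<close>, the kernel and the image of a high
  power of \<open>f\<close> cannot both be nontrivial.\<close>

lemma injective_or_nilpotent:
  assumes noeth: "noeth_under G (carrier G) A"
    and uniform: "\<And>K1 K2. K1 \<lhd> G \<Longrightarrow> K2 \<lhd> G \<Longrightarrow> K1 \<subseteq> A \<Longrightarrow> K2 \<subseteq> A \<Longrightarrow>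
      K1 \<inter> K2 = {\<one>} \<Longrightarrow> K1 = {\<one>} \<or> K2 = {\<one>}"
    and fA: "\<And>a. a \<in> A \<Longrightarrow> f a \<in> A"
    and fm: "\<And>a b. a \<in> A \<Longrightarrow> b \<in> A \<Longrightarrow> f (a \<otimes> b) = f a \<otimes> f b"
    and fc: "\<And>g a. g \<in> carrier G \<Longrightarrow> a \<in> A \<Longrightarrow> f (cj g a) = cj g (f a)"
  shows "(\<forall>a\<in>A. f a = \<one> \<longrightarrow> a = \<one>) \<or> (\<exists>e. \<forall>a\<in>A. (f ^^ e) a = \<one>)"
proof -
  have FA: "(f ^^ e) a \<in> A" if "a \<in> A" for e a
    by (induction e) (use that fA in auto)
  have Fm: "(f ^^ e) (a \<otimes> b) = (f ^^ e) a \<otimes> (f ^^ e) b" if "a \<in> A" "b \<in> A" for e a b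
    by (induction e) (use that fm FA in auto)
  have Fc: "(f ^^ e) (cj g a) = cj g ((f ^^ e) a)" if "g \<in> carrier G" "a \<in> A" for e g a
    by (induction e) (use that fc FA in auto)
  have F1: "(f ^^ e) \<one> = \<one>" for e
    using Fm[of \<one> \<one> e] FA[of \<one> e] by (metis A_carrier A_one l_cancel_one' r_one)
  have Fi: "(f ^^ e) (inv a) = inv ((f ^^ e) a)" if "a \<in> A" for e a
    using Fm[of "inv a" a e] F1[of e] that FA[of a e] FA[of "inv a" e]
    by (intro inv_equality[symmetric]) auto
  define K where "K e = {a \<in> A. (f ^^ e) a = \<one>}" for e
  define R where "R e = (f ^^ e) ` A" for e
  have Ksub: "subgroup (K e) G" for e
    by (rule subgroup_by_quotients) (use F1 Fm Fi in \<open>auto simp: K_def\<close>)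
  have Kcl: "conj_closed G (carrier G) (K e)" for e
    using Fc by (auto simp: K_def conj_closed_iff)
  have "subgroup (R e) G" for e
  proof (rule subgroup_by_quotients)
    show "R e \<subseteq> carrier G" using FA by (auto simp: R_def)
    show "\<one> \<in> R e" unfolding R_def using F1 A_one by (metis image_eqI)
    fix a b assume "a \<in> R e" "b \<in> R e"
    then obtain c d where cd: "c \<in> A" "d \<in> A" "a = (f ^^ e) c" "b = (f ^^ e) d" by (auto simp: R_def)
    then have "a \<otimes> inv b = (f ^^ e) (c \<otimes> inv d)" using Fm Fi by simp
    then show "a \<otimes> inv b \<in> R e" unfolding R_def using cd by (metis A_inv A_mult image_eqI)
  qed
  moreover have "conj_closed G (carrier G) (R e)" for e
    unfolding conj_closed_iff
  proof (intro ballI)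
    fix g b assume g: "g \<in> carrier G" and "b \<in> R e"
    then obtain a where a: "a \<in> A" "b = (f ^^ e) a" by (auto simp: R_def)
    then have "cj g b = (f ^^ e) (cj g a)" using Fc g by simp
    then show "cj g b \<in> R e" unfolding R_def using a(1) g by simp
  qed
  ultimately have Rn: "R e \<lhd> G" for e by (intro conj_closed_normal)
  have Kmono: "K e \<subseteq> K (Suc e)" for e
    using F1[of 1] by (auto simp: K_def)
  obtain n where n: "\<And>k. k \<ge> n \<Longrightarrow> K k = K n"
  proof -
    have "\<exists>n. \<forall>k\<ge>n. K k = K n"
      by (intro noeth_underD[OF noeth] Ksub Kcl Kmono) (auto simp: K_def)
    then show ?thesis using that by blast
  qed
  \<comment> \<open>The kernels are constant from \<open>n\<close> on. The successor makes the
    exponent positive, so that \<open>f a = \<one>\<close> implies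
    \<open>a \<in> K e\<close>.\<close>
  define e where "e = Suc n"
  have "K e \<inter> R e = {\<one>}"
  proof -
    \<comment> \<open>If \<open>x = (f ^^ e) a\<close> is killed by \<open>f ^^ e\<close>, then
      \<open>a \<in> K (e + e) = K e\<close>, so \<open>x\<close> is trivial.\<close>
    have "x = \<one>" if "x \<in> K e" and xR: "x \<in> R e" for x
    proof -
      obtain a where a: "a \<in> A" "x = (f ^^ e) a" using xR by (auto simp: R_def)
      then have "(f ^^ (e + e)) a = \<one>" using \<open>x \<in> K e\<close> by (simp add: K_def funpow_add)
      then have "a \<in> K (e + e)" using a by (simp add: K_def)
      then have "a \<in> K e" using n[of "e + e"] n[of e] by (simp add: e_def)
      then show ?thesis using a by (simp add: K_def)
    qed
    moreover have "\<one> \<in> K e" "\<one> \<in> R e" using Ksub Rn by (auto intro: subgroup.one_closed normal_imp_subgroup)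
    ultimately show ?thesis by blast
  qed
  moreover have "K e \<subseteq> A" "R e \<subseteq> A" using FA by (auto simp: K_def R_def)
  ultimately consider "K e = {\<one>}" | "R e = {\<one>}"
    using uniform[OF conj_closed_normal[OF Ksub Kcl] Rn] by blast
  then show ?thesis
  proof cases
    case 1
    have "a = \<one>" if "a \<in> A" "f a = \<one>" for a
    proof -
      have "(f ^^ e) a = \<one>" using that(2) F1[of n] by (simp only: e_def funpow_Suc_right o_apply)
      then show ?thesis using 1 that by (auto simp: K_def)
    qed
    then show ?thesis by blast
  next
    case 2
    then show ?thesis by (auto simp: R_def)
  qed
qed

text \<open>On \<open>A\<close> this is the module operator \<open>x - 1\<close>, so its nilpotency
  says that \<open>x\<close> acts unipotently. For \<open>z\<close> outside \<open>A\<close> it is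
  the commutator of \<open>x\<close> and \<open>z\<close>, which again lies in
  \<open>A\<close>.\<close>

definition comm_with :: "'a \<Rightarrow> 'a \<Rightarrow> 'a" where "comm_with x z = cj x z \<otimes> inv z"

lemma comm_with_A [simp]: "x \<in> carrier G \<Longrightarrow> z \<in> carrier G \<Longrightarrow> comm_with x z \<in> A"
  using commutator_in_A by (simp add: comm_with_def cj_def)

lemma comm_with_eq_one_iff:
  "x \<in> carrier G \<Longrightarrow> z \<in> carrier G \<Longrightarrow> comm_with x z = \<one> \<longleftrightarrow> x \<otimes> z = z \<otimes> x"
  by (simp add: comm_with_def cj_def commutator_eq_one_iff)

text \<open>The last nontrivial iterated commutator \<open>b = [x, z]\<close> commutes with \<open>x\<close>, so that
  \<open>[x^n, z] = b^n\<close>.\<close>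

lemma commute_if_power_commutes:
  assumes tf: "\<And>a. a \<in> A \<Longrightarrow> a [^] (n::nat) = \<one> \<Longrightarrow> a = \<one>"
    and x: "x \<in> carrier G" and nil: "\<And>a. a \<in> A \<Longrightarrow> (comm_with x ^^ e) a = \<one>"
    and y: "y \<in> carrier G" and comm: "x [^] n \<otimes> y = y \<otimes> x [^] n"
  shows "x \<otimes> y = y \<otimes> x"
proof -
  \<comment> \<open>Induction on the number \<open>k\<close> of commutators with \<open>x\<close>
    after which \<open>z\<close> becomes trivial.\<close>
  have "x \<otimes> z = z \<otimes> x"
    if "z \<in> carrier G" "x [^] n \<otimes> z = z \<otimes> x [^] n" "(comm_with x ^^ k) z = \<one>" for z k
    using that
  proof (induction k arbitrary: z)
    case 0
    then show ?case using x by simp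
  next
    case (Suc k)
    define b where "b = comm_with x z"
    have bA: "b \<in> A" and bc: "b \<in> carrier G" using Suc.prems x by (simp_all add: b_def)
    have xn: "x [^] n \<in> carrier G" using x by simp
    have xx: "x [^] n \<otimes> x = x \<otimes> x [^] n" using nat_pow_commute[OF x x] by simp
    have "x [^] n \<otimes> b = b \<otimes> x [^] n"
    proof -
      have "cj (x [^] n) x = x" "cj (x [^] n) z = z"
        using cj_fixed_iff[OF xn] xx Suc.prems x by simp_all
      moreover from this have "cj (x [^] n) (inv x) = inv x" "cj (x [^] n) (inv z) = inv z"
        using Suc.prems x xn by (simp_all only: cj_inv)
      ultimately have "cj (x [^] n) b = b"
        using Suc.prems x xn unfolding b_def comm_with_def cj_def[of x] by (simp add: cj_mult)
      then show ?thesis using cj_fixed_iff[OF xn bc] by simp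
    qed
    moreover have "(comm_with x ^^ k) b = \<one>"
      using Suc.prems(3) by (simp only: b_def funpow_Suc_right o_apply)
    ultimately have xb: "x \<otimes> b = b \<otimes> x" by (rule Suc.IH[OF bc])
    have "cj (x [^] m) z = b [^] m \<otimes> z" for m :: nat
    proof (induction m)
      case 0
      then show ?case using Suc.prems by simp
    next
      case (Suc m)
      have z: "z \<in> carrier G" by fact
      have "cj x z = b \<otimes> z" using x z by (simp add: b_def comm_with_def m_assoc)
      moreover have "cj (x [^] m) b = b" using cj_fixed_iff nat_pow_commute[OF x bc xb] x bc by simp
      ultimately have "cj (x [^] Suc m) z = b \<otimes> (b [^] m \<otimes> z)"
        using Suc.IH x z bc by (simp add: cj_comp cj_mult)
      also have "\<dots> = b [^] Suc m \<otimes> z" using bc z nat_pow_commute[OF bc bc] by (simp flip: m_assoc)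
      finally show ?case .
    qed
    then have "z = b [^] n \<otimes> z" using cj_fixed_iff[OF xn] Suc.prems by metis
    then have "b [^] n = \<one>" using Suc.prems bc by (metis nat_pow_closed r_cancel_one')
    then have "b = \<one>" by (rule tf[OF bA])
    then show ?case using comm_with_eq_one_iff[OF x] Suc.prems by (simp add: b_def)
  qed
  \<comment> \<open>\<open>y\<close> need not lie in \<open>A\<close>; the additional application
    moves it there.\<close>
  moreover have "(comm_with x ^^ Suc e) y = \<one>"
    using nil[of "comm_with x y"] x y by (simp only: funpow_Suc_right o_apply comm_with_A)
  ultimately show ?thesis using y comm by blast
qed

lemma cj_nat_pow:
  assumes "g \<in> carrier G" "a \<in> carrier G"
  shows "cj g (a [^] (n::nat)) = cj g a [^] n"
  by (induction n) (use assms in \<open>simp_all add: cj_mult\<close>)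

text \<open>A large family is arranged as a grid. The bounded rank gives in each row an element of
  \<open>A\<close> built from the \<open>x\<close> of that row, with a distinguished column, and
  then an element of \<open>A\<close> built from the \<open>y\<close> at the distinguished places,
  with a distinguished row. In that row the two elements commute and share a single index, with
  exponents prime to \<open>p\<close>; unipotency makes the pair at that index commute.\<close>

lemma separation_bounded_if_uniform:
  assumes S: "finite S" "S \<subseteq> carrier G" "generate G S = carrier G"
    and noeth: "noeth_under G (carrier G) A"
    and uniform: "\<And>K1 K2. K1 \<lhd> G \<Longrightarrow> K2 \<lhd> G \<Longrightarrow> K1 \<subseteq> A \<Longrightarrow> K2 \<subseteq> A \<Longrightarrow>
      K1 \<inter> K2 = {\<one>} \<Longrightarrow> K1 = {\<one>} \<or> K2 = {\<one>}"
  shows "separation_bounded G"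
proof -
  \<comment> \<open>A nontrivial fixed element makes the operator \<open>z - 1\<close> noninjective,
    hence nilpotent.\<close>
  have nil: "\<exists>e. \<forall>b\<in>A. (comm_with z ^^ e) b = \<one>"
    if z: "z \<in> carrier G" and a: "a \<in> A" "a \<noteq> \<one>" "z \<otimes> a = a \<otimes> z" for z a
  proof -
    have "(\<forall>b\<in>A. comm_with z b = \<one> \<longrightarrow> b = \<one>) \<or> (\<exists>e. \<forall>b\<in>A. (comm_with z ^^ e) b = \<one>)"
    proof (rule injective_or_nilpotent[OF noeth uniform])
      show "comm_with z b \<in> A" if "b \<in> A" for b using that z by simp
      show "comm_with z (b \<otimes> c) = comm_with z b \<otimes> comm_with z c" if "b \<in> A" "c \<in> A" for b c
        using that z unfolding comm_with_def by (simp add: cj_mult A_quotient_mult)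
      show "comm_with z (cj g b) = cj g (comm_with z b)" if "g \<in> carrier G" "b \<in> A" for g b
        using that z unfolding comm_with_def by (simp add: cj_mult cj_inv cj_commute[of z g b])
    qed
    moreover have "comm_with z a = \<one>" using a z comm_with_eq_one_iff by simp
    ultimately show ?thesis using a by blast
  qed
  \<comment> \<open>Either no prime power map kills a nontrivial element, and \<open>A\<close> is
    torsion-free, or for some prime \<open>q\<close> this map is noninjective, hence nilpotent, and
    a power of \<open>q\<close> kills \<open>A\<close>.\<close>
  have "\<exists>p::nat. Factorial_Ring.prime p \<and> (\<forall>n. \<not> p dvd n \<longrightarrow> (\<forall>a\<in>A. a [^] n = \<one> \<longrightarrow> a = \<one>))"
  proof (cases "\<forall>q::nat. Factorial_Ring.prime q \<longrightarrow> (\<forall>a\<in>A. a [^] q = \<one> \<longrightarrow> a = \<one>)")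
    case True
    have "a = \<one>" if "n \<noteq> 0" "a \<in> A" "a [^] n = \<one>" for a and n :: nat
      using that
    proof (induction n rule: less_induct)
      case (less n)
      show ?case
      proof (cases "n = 1")
        case False
        then obtain q where q: "Factorial_Ring.prime q" "q dvd n" using prime_factor_nat by blast
        then obtain m where m: "n = m * q" by (metis dvd_def mult.commute)
        have "m < n" "m \<noteq> 0" using m less.prems(1) prime_gt_1_nat[OF q(1)] by auto
        moreover have "(a [^] m) [^] q = \<one>" using less.prems m by (simp add: nat_pow_pow)
        then have "a [^] m = \<one>" using True q(1) less.prems(2) subgroup_int_pow_closed[OF A_subgroup, of a "int m"]
          by (simp add: int_pow_int)
        ultimately show ?thesis using less by blast
      qed (use less.prems in simp)
    qed
    \<comment> \<open>Any prime serves here, and \<open>\<not> p dvd n\<close> excludes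
      \<open>n = 0\<close>.\<close>
    then show ?thesis using two_is_prime_nat by (metis dvd_0_right)
  next
    case False
    then obtain q :: nat where q: "Factorial_Ring.prime q" "\<not> (\<forall>a\<in>A. a [^] q = \<one> \<longrightarrow> a = \<one>)" by blast
    define f where "f a = a [^] q" for a
    have "(\<forall>a\<in>A. f a = \<one> \<longrightarrow> a = \<one>) \<or> (\<exists>e. \<forall>a\<in>A. (f ^^ e) a = \<one>)"
    proof (rule injective_or_nilpotent[OF noeth uniform])
      show "f a \<in> A" if "a \<in> A" for a
        using subgroup_int_pow_closed[OF A_subgroup that, of "int q"] by (simp add: f_def int_pow_int)
      show "f (a \<otimes> b) = f a \<otimes> f b" if "a \<in> A" "b \<in> A" for a b
        using that pow_mult_distrib[OF A_comm[OF that]] by (simp add: f_def)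
      show "f (cj g a) = cj g (f a)" if "g \<in> carrier G" "a \<in> A" for g a
        using that by (simp add: f_def cj_nat_pow)
    qed
    then obtain e where e: "\<And>a. a \<in> A \<Longrightarrow> (f ^^ e) a = \<one>" using q by (auto simp: f_def)
    have fe: "(f ^^ k) a = a [^] (q ^ k)" if "a \<in> A" for k a
      by (induction k) (use that in \<open>simp_all add: f_def nat_pow_pow mult.commute\<close>)
    have "a = \<one>" if "\<not> q dvd n" "a \<in> A" "a [^] n = \<one>" for n a
    proof (rule eq_one_if_coprime_powers)
      show "Rings.coprime (q ^ e) n" using prime_imp_coprime[OF q(1) that(1)] by simp
    qed (use that e fe in auto)
    then show ?thesis using q(1) by blast
  qed
  then obtain p :: nat where p: "Factorial_Ring.prime p"
    and tf: "\<And>n a. \<not> p dvd n \<Longrightarrow> a \<in> A \<Longrightarrow> a [^] n = \<one> \<Longrightarrow> a = \<one>" by blast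
  \<comment> \<open>\<open>D\<close> has more than \<open>card S\<close> elements and contains 0 and
    1 even for empty \<open>S\<close>, so the grid has a second place next to any given one.\<close>
  define D where "D = {..Suc (card S)}"
  have D: "finite D" "card S < card D" by (auto simp: D_def)
  have no_grid: False if fam: "separated_family G (D \<times> D) x y" for x y
  proof -
    have xc: "x i \<in> carrier G" and yc: "y i \<in> carrier G" and nc: "x i \<otimes> y i \<noteq> y i \<otimes> x i"
      if "i \<in> D \<times> D" for i using fam that by (auto simp: separated_family_def)
    have xx: "x i \<otimes> x j = x j \<otimes> x i" and xy: "x i \<otimes> y j = y j \<otimes> x i" and yy: "y i \<otimes> y j = y j \<otimes> y i"
      if "i \<in> D \<times> D" "j \<in> D \<times> D" "i \<noteq> j" for i j
      using fam that unfolding separated_family_def by metis+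
    have nilxy: "(\<exists>e. \<forall>b\<in>A. (comm_with (x i) ^^ e) b = \<one>) \<and> (\<exists>e. \<forall>b\<in>A. (comm_with (y i) ^^ e) b = \<one>)"
      if i: "i \<in> D \<times> D" for i
    proof -
      define j where "j = (if i = (0, 0) then (1, 1) else (0, 0) :: nat \<times> nat)"
      have j: "j \<in> D \<times> D" "j \<noteq> i" by (auto simp: j_def D_def)
      \<comment> \<open>The commutator of another pair is a nontrivial element of \<open>A\<close>
        fixed by both \<open>x i\<close> and \<open>y i\<close>.\<close>
      define a where "a = comm_with (x j) (y j)"
      have a: "a \<in> A" "a \<noteq> \<one>" using xc yc nc j comm_with_eq_one_iff by (simp_all add: a_def)
      have comm: "z \<otimes> a = a \<otimes> z" if z: "z \<in> carrier G" "z \<otimes> x j = x j \<otimes> z" "z \<otimes> y j = y j \<otimes> z" for z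
      proof (rule generate_commute[of z "{x j, y j}"])
        have "x j \<in> generate G {x j, y j}" "y j \<in> generate G {x j, y j}" by (auto intro: generate.incl)
        then show "a \<in> generate G {x j, y j}"
          unfolding a_def comm_with_def cj_def
          using generate_m_inv_closed[of "{x j, y j}"] xc yc j(1) by (auto intro!: generate.eng)
      qed (use z xc yc j in auto)
      have "x i \<otimes> a = a \<otimes> x i" "y i \<otimes> a = a \<otimes> y i"
        using comm[of "x i"] comm[of "y i"] xc yc xx[of i j] xy[of i j] xy[of j i] yy[of i j] i j by metis+
      then show ?thesis using nil a xc yc i by blast
    qed
    \<comment> \<open>In each row \<open>r\<close> the rank argument singles out a column
      \<open>s r\<close>.\<close>
    have "\<exists>s n c. s \<in> D \<and> \<not> p dvd n \<and> c \<in> generate G ((\<lambda>j. x (r, j)) ` (D - {s})) \<and> x (r, s) [^] (n::nat) \<otimes> c \<in> A"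
      if "r \<in> D" for r
      using power_product_in_A[OF S D, of "\<lambda>j. x (r, j)" p] xc p that by blast
    then obtain s n c where s: "\<And>r. r \<in> D \<Longrightarrow> s r \<in> D" and n: "\<And>r. r \<in> D \<Longrightarrow> \<not> p dvd n r"
      and c: "\<And>r. r \<in> D \<Longrightarrow> c r \<in> generate G ((\<lambda>j. x (r, j)) ` (D - {s r}))"
      and XA: "\<And>r. r \<in> D \<Longrightarrow> x (r, s r) [^] (n r :: nat) \<otimes> c r \<in> A" by metis
    \<comment> \<open>Applied to the \<open>y\<close> at the places \<open>(r, s r)\<close>, it
      singles out one row.\<close>
    obtain r k c' where r: "r \<in> D" and k: "\<not> p dvd k"
      and c': "c' \<in> generate G ((\<lambda>r. y (r, s r)) ` (D - {r}))" and YA: "y (r, s r) [^] (k::nat) \<otimes> c' \<in> A"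
      using power_product_in_A[OF S D, of "\<lambda>r. y (r, s r)" p] yc p s by blast
    define u where "u = x (r, s r)"
    define v where "v = y (r, s r)"
    define X' where "X' = u [^] n r \<otimes> c r"
    have rs: "(r, s r) \<in> D \<times> D" using r s by simp
    have uv: "u \<in> carrier G" "v \<in> carrier G" using xc yc rs by (auto simp: u_def v_def)
    have rowc: "(\<lambda>j. x (r, j)) ` (D - {s r}) \<subseteq> carrier G" using xc r by auto
    have colc: "(\<lambda>r. y (r, s r)) ` (D - {r}) \<subseteq> carrier G" using yc s by auto
    have cc: "c r \<in> carrier G" "c' \<in> carrier G"
      using generate_in_carrier[OF rowc c[OF r]] generate_in_carrier[OF colc c'] by auto
    have X'A: "X' \<in> A" using XA[OF r] by (simp add: X'_def u_def)
    have vA: "v [^] k \<otimes> c' \<in> A" using YA by (simp add: v_def)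
    have vc: "v \<otimes> c r = c r \<otimes> v"
    proof (rule generate_commute[OF uv(2) rowc _ c[OF r]])
      fix t assume "t \<in> (\<lambda>j. x (r, j)) ` (D - {s r})"
      then obtain j where "j \<in> D" "j \<noteq> s r" "t = x (r, j)" by auto
      then show "v \<otimes> t = t \<otimes> v" using xy[of "(r, j)" "(r, s r)"] rs by (simp add: v_def)
    qed
    have Xc': "X' \<otimes> c' = c' \<otimes> X'"
    proof (rule generate_commute_generate[OF _ colc _ _ c'])
      let ?T = "(\<lambda>j. x (r, j)) ` D"
      show T: "?T \<subseteq> carrier G" using xc r by auto
      have "c r \<in> generate G ?T" using c[OF r] mono_generate[of "(\<lambda>j. x (r, j)) ` (D - {s r})" ?T] by blast
      moreover have "u \<in> generate G ?T" using rs by (auto simp: u_def intro: generate.incl)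
      ultimately show "X' \<in> generate G ?T"
        using subgroup_int_pow_closed[OF generate_is_subgroup[OF T], of u "int (n r)"]
        unfolding X'_def by (auto simp: int_pow_int intro: generate.eng)
      fix a b assume "a \<in> ?T" "b \<in> (\<lambda>r. y (r, s r)) ` (D - {r})"
      then obtain j r' where jr: "j \<in> D" "r' \<in> D" "r' \<noteq> r" "a = x (r, j)" "b = y (r', s r')" by auto
      then show "a \<otimes> b = b \<otimes> a" using xy[of "(r, j)" "(r', s r')"] r s by simp
    qed
    \<comment> \<open>\<open>v [^] k \<otimes> c'\<close> and \<open>X'\<close> commute as elements
      of \<open>A\<close>, and \<open>X'\<close> commutes with \<open>c'\<close> because no index is
      common to both; so \<open>c'\<close> can be cancelled.\<close>
    have "v [^] k \<otimes> X' = X' \<otimes> v [^] k"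
    proof -
      have "(v [^] k \<otimes> X') \<otimes> c' = v [^] k \<otimes> c' \<otimes> X'" using uv cc X'A Xc' by (simp add: m_assoc)
      also have "\<dots> = (X' \<otimes> v [^] k) \<otimes> c'" using A_comm[OF vA X'A] uv cc X'A by (simp add: m_assoc)
      finally show ?thesis using uv cc A_carrier[OF X'A] by (subst (asm) right_cancel) simp_all
    qed
    moreover obtain e where "\<And>b. b \<in> A \<Longrightarrow> (comm_with v ^^ e) b = \<one>"
      using nilxy[OF rs] unfolding v_def by blast
    \<comment> \<open>First the power of \<open>v\<close> is removed, then, after cancelling
      \<open>c r\<close>, that of \<open>u\<close>.\<close>
    ultimately have "v \<otimes> X' = X' \<otimes> v"
      using commute_if_power_commutes[of k v e X'] tf[OF k] uv X'A by simp
    then have "u [^] n r \<otimes> v \<otimes> c r = v \<otimes> u [^] n r \<otimes> c r"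
      unfolding X'_def using vc uv cc by (simp add: m_assoc)
    then have "u [^] n r \<otimes> v = v \<otimes> u [^] n r" using uv cc by (subst (asm) right_cancel) simp_all
    moreover obtain e where "\<And>b. b \<in> A \<Longrightarrow> (comm_with u ^^ e) b = \<one>"
      using nilxy[OF rs] unfolding u_def by blast
    ultimately have "u \<otimes> v = v \<otimes> u"
      using commute_if_power_commutes[of "n r" u e v] tf[OF n[OF r]] uv by simp
    then show False using nc[OF rs] by (simp add: u_def v_def)
  qed
  have "card I \<le> card (D \<times> D)" if fin: "finite I" and fam: "separated_family G I x y" for I :: "nat set" and x y
  proof (rule ccontr)
    assume "\<not> ?thesis"
    then obtain J where J: "J \<subseteq> I" "card J = card (D \<times> D)" using obtain_subset_with_card_n by (metis nat_le_linear)
    then have "finite J" using fin finite_subset by blast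
    then obtain f where "bij_betw f (D \<times> D) J"
      using J(2) D(1) finite_same_card_bij[of "D \<times> D" J] by auto
    then have "f ` (D \<times> D) = J" "inj_on f (D \<times> D)" by (auto simp: bij_betw_def)
    then have "separated_family G (D \<times> D) (x \<circ> f) (y \<circ> f)"
      using separated_family_subset[OF fam J(1)] by (intro separated_family_reindex) auto
    then show False by (rule no_grid)
  qed
  then show ?thesis unfolding separation_bounded_def by blast
qed

end

section \<open>Noetherian induction over the quotients\<close>

lemma (in group) separation_bounded_FactGroup_FactGroup:
  assumes K: "K \<lhd> G" and L: "L \<lhd> (G Mod K)"
    and bd: "separation_bounded (G Mod {g \<in> carrier G. K #> g \<in> L})"
  shows "separation_bounded ((G Mod K) Mod L)"
proof -
  interpret K: normal K G by fact
  interpret Q: group "G Mod K" by (rule K.factorgroup_is_group)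
  interpret L: normal L "G Mod K" by fact
  define h where "h g = L #>\<^bsub>G Mod K\<^esub> (K #> g)" for g
  interpret k: group_hom G "G Mod K" "\<lambda>a. K #> a" by (rule K.coset_group_hom)
  interpret l: group_hom "G Mod K" "(G Mod K) Mod L" "\<lambda>a. L #>\<^bsub>G Mod K\<^esub> a" by (rule L.coset_group_hom)
  have "h \<in> hom G ((G Mod K) Mod L)"
    unfolding h_def by (rule homI) (simp_all only: k.hom_mult l.hom_mult k.hom_closed l.hom_closed)
  then interpret h: group_hom G "(G Mod K) Mod L" h
    by (simp add: group_hom_def group_hom_axioms_def L.factorgroup_is_group is_group)
  have ker: "kernel G ((G Mod K) Mod L) h = {g \<in> carrier G. K #> g \<in> L}"
    using L.coset_eq_self_iff by (auto simp: kernel_def h_def carrier_FactGroup)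
  have "h ` carrier G = carrier ((G Mod K) Mod L)" by (auto simp: h_def carrier_FactGroup)
  \<comment> \<open>Third isomorphism theorem. It lets the maximality of a subgroup \<open>K\<close>
    among those of \<open>G\<close> be used for the quotients of \<open>G Mod K\<close>.\<close>
  then have iso: "(G Mod {g \<in> carrier G. K #> g \<in> L}) \<cong> ((G Mod K) Mod L)"
    using h.FactGroup_iso ker by simp
  have gr: "group (G Mod {g \<in> carrier G. K #> g \<in> L})"
    using h.normal_kernel ker normal.factorgroup_is_group by metis
  obtain f where "f \<in> iso ((G Mod K) Mod L) (G Mod {g \<in> carrier G. K #> g \<in> L})"
    using group.iso_sym[OF gr iso] by (auto simp: is_iso_def)
  then have "f \<in> hom ((G Mod K) Mod L) (G Mod {g \<in> carrier G. K #> g \<in> L})"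
    "inj_on f (carrier ((G Mod K) Mod L))" by (auto simp: iso_def bij_betw_def)
  then show ?thesis by (rule separation_bounded_inj_hom[OF L.factorgroup_is_group gr _ _ bd])
qed

lemma (in group) metabelian_separation_bounded:
  assumes S: "finite S" "S \<subseteq> carrier G" "generate G S = carrier G"
    and metab: "derived G (derived G (carrier G)) = {\<one>}"
  shows "separation_bounded G"
proof (rule ccontr)
  assume unbounded: "\<not> separation_bounded G"
  define A where "A = derived G (carrier G)"
  interpret abelian_by_abelian G A
    using metabelian_abelian_by_abelian[OF metab] by (simp add: A_def)
  have "noeth_under G (carrier G) A"
    unfolding A_def by (rule metabelian_noeth_under[OF S metab])
  moreover have "subgroup {\<one>} G" "{\<one>} \<subseteq> A" "conj_closed G (carrier G) {\<one>}"
    by (auto simp: triv_subgroup conj_closed_def)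
  \<comment> \<open>The trivial subgroup starts the search for a maximal \<open>K\<close>, since
    \<open>G Mod {\<one>}\<close> is a copy of \<open>G\<close>.\<close>
  moreover have "\<not> separation_bounded (G Mod {\<one>})"
  proof
    assume bd: "separation_bounded (G Mod {\<one>})"
    interpret one: normal "{\<one>}" G by (rule one_is_normal)
    have "inj_on (\<lambda>a. {\<one>} #> a) (carrier G)" by (auto simp: inj_on_def r_coset_def)
    then have "separation_bounded G"
      by (rule separation_bounded_inj_hom[OF is_group one.factorgroup_is_group one.r_coset_hom_Mod _ bd])
    then show False using unbounded by blast
  qed
  ultimately obtain K where K: "subgroup K G" "K \<subseteq> A" "conj_closed G (carrier G) K"
    and ubd: "\<not> separation_bounded (G Mod K)"
    and maxi: "\<And>K'. subgroup K' G \<Longrightarrow> K' \<subseteq> A \<Longrightarrow> conj_closed G (carrier G) K' \<Longrightarrow>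
        \<not> separation_bounded (G Mod K') \<Longrightarrow> K \<subseteq> K' \<Longrightarrow> K' = K"
    by (rule noeth_under_maximal[where P = "\<lambda>K. \<not> separation_bounded (G Mod K)"]) metis
  have Kn: "K \<lhd> G" by (rule conj_closed_normal[OF K(1,3)])
  then interpret K: normal K G .
  define H where "H = G Mod K"
  interpret H: group H unfolding H_def by (rule K.factorgroup_is_group)
  interpret h: group_hom G H "\<lambda>a. K #> a" unfolding H_def by (rule K.coset_group_hom)
  have onto: "(\<lambda>a. K #> a) ` carrier G = carrier H" by (simp add: H_def carrier_FactGroup)
  define S' where "S' = (\<lambda>a. K #> a) ` S"
  have S': "finite S'" "S' \<subseteq> carrier H" "generate H S' = carrier H"
    using S h.generate_img[OF S(2)] onto by (auto simp: S'_def)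
  have dH: "derived H (carrier H) = (\<lambda>a. K #> a) ` A"
    using h.derived_img[of "carrier G"] onto by (simp add: A_def)
  have "derived H (derived H (carrier H)) = {\<one>\<^bsub>H\<^esub>}"
    using h.derived_img[of A] metab A_subgroup by (simp add: dH subgroup.subset) (simp add: A_def)
  note metabH = this
  interpret HA: abelian_by_abelian H "derived H (carrier H)"
    by (rule H.metabelian_abelian_by_abelian[OF metabH])
  \<comment> \<open>The preimage of \<open>L\<close> in \<open>G\<close> is strictly larger than
    \<open>K\<close> and still lies in \<open>A\<close>, so the maximality of \<open>K\<close>
    bounds its quotient.\<close>
  have small: "separation_bounded (H Mod L)"
    if L: "L \<lhd> H" "L \<subseteq> derived H (carrier H)" "L \<noteq> {\<one>\<^bsub>H\<^esub>}" for L
  proof -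
    define L' where "L' = {g \<in> carrier G. K #> g \<in> L}"
    interpret L: normal L H by (rule L(1))
    have sub: "subgroup L' G"
    proof (rule subgroup_by_quotients)
      show "L' \<subseteq> carrier G" by (auto simp: L'_def)
      show "\<one> \<in> L'" unfolding L'_def using h.hom_one L.one_closed by (simp only: mem_Collect_eq one_closed)
      fix a b assume "a \<in> L'" "b \<in> L'"
      then have ab: "a \<in> carrier G" "b \<in> carrier G" "K #> a \<in> L" "K #> b \<in> L" by (auto simp: L'_def)
      then have "K #> (a \<otimes> inv b) = (K #> a) \<otimes>\<^bsub>H\<^esub> inv\<^bsub>H\<^esub> (K #> b)"
        by (simp only: h.hom_mult h.hom_inv inv_closed)
      also have "\<dots> \<in> L" using ab by (intro L.m_closed L.m_inv_closed)
      finally show "a \<otimes> inv b \<in> L'" using ab by (simp add: L'_def)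
    qed
    moreover have "conj_closed G (carrier G) L'"
      using L.inv_op_closed2 by (auto simp: L'_def conj_closed_def)
    moreover have "L' \<subseteq> A"
    proof
      fix g assume g: "g \<in> L'"
      then obtain a where a: "a \<in> A" "K #> g = K #> a" using L(2) unfolding dH L'_def by auto
      have "g \<in> K #> a" using a(2) rcos_self[OF _ K(1)] g by (auto simp: L'_def)
      then obtain k where "k \<in> K" "g = k \<otimes> a" by (auto simp: r_coset_def)
      then show "g \<in> A" using a(1) K(2) by auto
    qed
    moreover have "K \<subseteq> L'"
    proof
      fix k assume "k \<in> K"
      then have "k \<in> carrier G" "K #> k = \<one>\<^bsub>H\<^esub>" using K.coset_eq_self_iff by (auto simp: H_def)
      then show "k \<in> L'" by (simp add: L'_def)
    qed
    moreover have "L' \<noteq> K"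
    proof
      assume eq: "L' = K"
      have "l = \<one>\<^bsub>H\<^esub>" if l: "l \<in> L" for l
      proof -
        have "l \<in> carrier H" using l by simp
        then obtain g where g: "g \<in> carrier G" "l = K #> g" using onto by blast
        then have "g \<in> K" using l eq by (auto simp: L'_def)
        then show ?thesis using g K.coset_eq_self_iff by (simp add: H_def)
      qed
      then show False using L(3) L.one_closed by blast
    qed
    ultimately have "separation_bounded (G Mod L')" using maxi by blast
    then show ?thesis
      using separation_bounded_FactGroup_FactGroup[OF Kn] L(1) unfolding H_def L'_def by blast
  qed
  have "separation_bounded H"
  proof (rule HA.separation_bounded_if_uniform[OF S' H.metabelian_noeth_under[OF S' metabH]])
    fix K1 K2 assume K12: "K1 \<lhd> H" "K2 \<lhd> H" "K1 \<subseteq> derived H (carrier H)" "K2 \<subseteq> derived H (carrier H)"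
      "K1 \<inter> K2 = {\<one>\<^bsub>H\<^esub>}"
    show "K1 = {\<one>\<^bsub>H\<^esub>} \<or> K2 = {\<one>\<^bsub>H\<^esub>}"
    proof (rule ccontr)
      assume "\<not> ?thesis"
      then have bd: "separation_bounded (H Mod K1)" "separation_bounded (H Mod K2)" using small K12 by auto
      interpret K1: normal K1 H by fact
      interpret K2: normal K2 H by fact
      \<comment> \<open>As \<open>K1\<close> and \<open>K2\<close> meet trivially, \<open>H\<close>
        embeds into the product of its two bounded quotients.\<close>
      have "separation_bounded H"
      proof (rule separation_bounded_of_homs[OF H.is_group K1.factorgroup_is_group K2.factorgroup_is_group
            K1.r_coset_hom_Mod K2.r_coset_hom_Mod bd])
        fix g assume "g \<in> carrier H" "K1 #>\<^bsub>H\<^esub> g = \<one>\<^bsub>H Mod K1\<^esub>" "K2 #>\<^bsub>H\<^esub> g = \<one>\<^bsub>H Mod K2\<^esub>"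
        then have "g \<in> K1 \<inter> K2" using K1.coset_eq_self_iff K2.coset_eq_self_iff by simp
        then show "g = \<one>\<^bsub>H\<^esub>" using K12(5) by simp
      qed
      then show False using ubd by (simp add: H_def)
    qed
  qed
  then show False using ubd by (simp add: H_def)
qed

subsection \<open>Discriminating groups\<close>

lemma discriminating_finite:
  assumes "discriminating G" "finite T" "T \<subseteq> carrier (G \<times>\<times> G)"
  shows "\<exists>\<rho>\<in>hom (G \<times>\<times> G) G. \<forall>t\<in>T. \<rho> t = \<one>\<^bsub>G\<^esub> \<longleftrightarrow> t = \<one>\<^bsub>G \<times>\<times> G\<^esub>"
proof -
  obtain N :: nat and h where h: "T = h ` {i. i < N}"
    using finite_imp_nat_seg_image_inj_on[OF assms(2)] by blast
  then have "\<forall>i<N. h i \<in> carrier (G \<times>\<times> G)" using assms(3) by blast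
  then obtain \<rho> where \<rho>: "\<rho> \<in> hom (G \<times>\<times> G) G" "\<forall>i<N. \<rho> (h i) = \<one>\<^bsub>G\<^esub> \<longleftrightarrow> h i = \<one>\<^bsub>G \<times>\<times> G\<^esub>"
    using assms(1) unfolding discriminating_def by blast
  show ?thesis by (rule bexI[OF _ \<rho>(1)]) (use \<rho>(2) in \<open>simp add: h\<close>)
qed

context group
begin

text \<open>Compose the endomorphisms found so far with the first inclusion into
  \<open>G \<times>\<times> G\<close> and with \<open>\<rho>\<close>, and let the second inclusion
  give a new one. The two factors commute, and \<open>\<rho>\<close> need only detect finitely many
  elements built from \<open>c\<close>.\<close>

lemma discriminating_commuting_endomorphisms:
  fixes m :: nat
  assumes disc: "discriminating G" and c: "c \<in> carrier G" "c \<noteq> \<one>"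
  shows "\<exists>\<phi>. (\<forall>i<m. \<phi> i \<in> hom G G \<and> \<phi> i c \<noteq> \<one>) \<and>
    (\<forall>i<m. \<forall>j<m. i \<noteq> j \<longrightarrow> (\<forall>x\<in>carrier G. \<forall>y\<in>carrier G. \<phi> i x \<otimes> \<phi> j y = \<phi> j y \<otimes> \<phi> i x))"
proof (induction m)
  case (Suc m)
  then obtain \<phi> where hom: "\<And>i. i < m \<Longrightarrow> \<phi> i \<in> hom G G" and nt: "\<And>i. i < m \<Longrightarrow> \<phi> i c \<noteq> \<one>"
    and comm: "\<And>i j x y. i < m \<Longrightarrow> j < m \<Longrightarrow> i \<noteq> j \<Longrightarrow> x \<in> carrier G \<Longrightarrow> y \<in> carrier G \<Longrightarrow>
      \<phi> i x \<otimes> \<phi> j y = \<phi> j y \<otimes> \<phi> i x" by metis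
  have cl: "\<phi> i x \<in> carrier G" if "i < m" "x \<in> carrier G" for i x
    using hom[OF that(1)] that(2) by (rule hom_in_carrier)
  define T where "T = insert (\<one>, c) ((\<lambda>i. (\<phi> i c, \<one>)) ` {..<m})"
  have "finite T" "T \<subseteq> carrier (G \<times>\<times> G)" using c cl by (auto simp: T_def)
  then obtain \<rho> where \<rho>: "\<rho> \<in> hom (G \<times>\<times> G) G" and inj: "\<And>t. t \<in> T \<Longrightarrow> \<rho> t = \<one> \<longleftrightarrow> t = (\<one>, \<one>)"
    using discriminating_finite[OF disc, of T] unfolding one_DirProd by blast
  have \<rho>m: "\<rho> (a, b) \<otimes> \<rho> (a', b') = \<rho> (a \<otimes> a', b \<otimes> b')"
    if "a \<in> carrier G" "b \<in> carrier G" "a' \<in> carrier G" "b' \<in> carrier G" for a b a' b'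
    using hom_mult[OF \<rho>, of "(a, b)" "(a', b')"] that by simp
  have \<rho>c: "\<rho> (a, b) \<in> carrier G" if "a \<in> carrier G" "b \<in> carrier G" for a b
    using hom_in_carrier[OF \<rho>, of "(a, b)"] that by simp
  define \<psi> where "\<psi> i x = (if i < m then \<rho> (\<phi> i x, \<one>) else \<rho> (\<one>, x))" for i x
  have "\<psi> i \<in> hom G G" for i
    using cl \<rho>c \<rho>m hom_mult[OF hom] by (intro homI) (auto simp: \<psi>_def)
  moreover have "\<psi> i c \<noteq> \<one>" for i
    using inj nt c by (auto simp: \<psi>_def T_def)
  moreover have "\<psi> i x \<otimes> \<psi> j y = \<psi> j y \<otimes> \<psi> i x"
    if "i < Suc m" "j < Suc m" "i \<noteq> j" "x \<in> carrier G" "y \<in> carrier G" for i j x y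
    using that comm[of i j x y] cl \<rho>m by (auto simp: \<psi>_def)
  ultimately show ?case by (intro exI[of _ \<psi>]) blast
qed simp

lemma discriminating_solvable_abelian:
  assumes disc: "discriminating G" and fg: "finitely_generated_group G" and solv: "solvable G"
  shows "comm_group G"
proof -
  define D where "D = derived G (carrier G)"
  have Dc: "D \<subseteq> carrier G" unfolding D_def by (rule derived_in_carrier) simp
  have "D = {\<one>}"
  proof (rule ccontr)
    assume D: "D \<noteq> {\<one>}"
    \<comment> \<open>\<open>k\<close> is the derived length; it is at least 2 because
      \<open>D\<close> is nontrivial.\<close>
    obtain k where k: "(derived G ^^ k) (carrier G) = {\<one>}"
      and mink: "\<And>l. (derived G ^^ l) (carrier G) = {\<one>} \<Longrightarrow> k \<le> l"
      using solv solvable_iff_trivial_derived_seq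
        exists_least_iff[of "\<lambda>k. (derived G ^^ k) (carrier G) = {\<one>}"] by (metis not_le)
    have "k \<noteq> 0"
    proof
      assume "k = 0"
      then have "D \<subseteq> {\<one>}" using k Dc by simp
      then show False using D subgroup.one_closed[OF derived_is_subgroup[of "carrier G"]] by (auto simp: D_def)
    qed
    moreover have "k \<noteq> 1"
    proof
      assume "k = 1"
      then show False using k D by (simp add: D_def)
    qed
    ultimately obtain j where j: "k = Suc (Suc j)" by (metis One_nat_def not0_implies_Suc)
    have shift: "(derived G ^^ Suc l) (carrier G) = (derived G ^^ l) D" for l
      by (simp only: funpow_Suc_right o_apply D_def)
    have "subgroup ((derived G ^^ Suc j) (carrier G)) G" by (rule exp_of_derived_is_subgroup[OF subgroup_self])
    moreover have "(derived G ^^ Suc j) (carrier G) \<noteq> {\<one>}"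
      using mink[of "Suc j"] unfolding j by (metis Suc_n_not_le_n)
    \<comment> \<open>The last nontrivial derived subgroup arises from \<open>D\<close> by
      \<open>j\<close> derivations, while the same number leads from \<open>D2\<close> to the
      trivial group.\<close>
    ultimately obtain c where c: "c \<in> (derived G ^^ j) D" "c \<noteq> \<one>"
      using subgroup.one_closed unfolding shift by blast
    have cc: "c \<in> carrier G" using c(1) exp_of_derived_in_carrier[OF Dc] by blast
    define D2 where "D2 = derived G D"
    have top: "(derived G ^^ j) D2 = {\<one>}"
      using k unfolding j shift by (simp only: funpow_Suc_right o_apply D2_def)
    have D2n: "D2 \<lhd> G" unfolding D2_def D_def by (rule derived_is_normal[OF derived_self_is_normal])
    then interpret D2: normal D2 G .
    define P where "P = G Mod D2"
    interpret P: group P unfolding P_def by (rule D2.factorgroup_is_group)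
    interpret h: group_hom G P "\<lambda>a. D2 #> a" unfolding P_def by (rule D2.coset_group_hom)
    have onto: "(\<lambda>a. D2 #> a) ` carrier G = carrier P" by (simp add: P_def carrier_FactGroup)
    obtain S where S: "finite S" "S \<subseteq> carrier G" "generate G S = carrier G"
      using fg unfolding finitely_generated_group_def by blast
    have "separation_bounded P"
    proof (rule P.metabelian_separation_bounded)
      show "finite ((\<lambda>a. D2 #> a) ` S)" using S by simp
      show "(\<lambda>a. D2 #> a) ` S \<subseteq> carrier P" using S by auto
      show "generate P ((\<lambda>a. D2 #> a) ` S) = carrier P" using h.generate_img[OF S(2)] S(3) onto by simp
      have "derived P (derived P (carrier P)) = (\<lambda>a. D2 #> a) ` D2"
        using h.derived_img[of "carrier G"] h.derived_img[OF Dc] onto by (simp add: D_def D2_def)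
      also have "\<dots> = {\<one>\<^bsub>P\<^esub>}"
        using D2.coset_eq_self_iff D2.one_closed D2.subset by (auto simp: P_def image_iff intro!: bexI[of _ \<one>])
      finally show "derived P (derived P (carrier P)) = {\<one>\<^bsub>P\<^esub>}" .
    qed
    then obtain m where m: "\<And>(I :: nat set) x y. finite I \<Longrightarrow> separated_family P I x y \<Longrightarrow> card I \<le> m"
      unfolding separation_bounded_def by blast
    obtain \<phi> where hom: "\<And>i. i < Suc m \<Longrightarrow> \<phi> i \<in> hom G G" and nt: "\<And>i. i < Suc m \<Longrightarrow> \<phi> i c \<noteq> \<one>"
      and comm: "\<And>i j x y. i < Suc m \<Longrightarrow> j < Suc m \<Longrightarrow> i \<noteq> j \<Longrightarrow> x \<in> carrier G \<Longrightarrow> y \<in> carrier G \<Longrightarrow>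
        \<phi> i x \<otimes> \<phi> j y = \<phi> j y \<otimes> \<phi> i x"
      using discriminating_commuting_endomorphisms[OF disc cc c(2), of "Suc m"] by metis
    \<comment> \<open>If all commutators of the image of \<open>\<phi> i\<close> were in
      \<open>D2\<close>, then \<open>\<phi> i\<close> would map \<open>D\<close> into
      \<open>D2\<close> and so kill the \<open>j\<close>-th derived subgroup of \<open>D\<close>,
      which contains \<open>c\<close>.\<close>
    have "\<exists>x y. x \<in> carrier G \<and> y \<in> carrier G \<and>
        \<phi> i x \<otimes> \<phi> i y \<otimes> inv (\<phi> i x) \<otimes> inv (\<phi> i y) \<notin> D2" if i: "i < Suc m" for i
    proof (rule ccontr)
      assume contra: "\<not> ?thesis"
      interpret f: group_hom G G "\<phi> i" using hom[OF i] by unfold_locales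
      have "derived_set G (\<phi> i ` carrier G) \<subseteq> D2" using contra by auto
      then have "derived G (\<phi> i ` carrier G) \<subseteq> D2"
        unfolding derived_def by (rule generate_subgroup_incl[OF _ D2.is_subgroup])
      then have "\<phi> i ` D \<subseteq> D2" using f.derived_img[of "carrier G"] by (simp add: D_def)
      then have "(derived G ^^ j) (\<phi> i ` D) \<subseteq> {\<one>}" using mono_exp_of_derived top by blast
      then have "\<phi> i ` ((derived G ^^ j) D) \<subseteq> {\<one>}" using f.exp_of_derived_img[OF Dc] by simp
      then show False using c(1) nt[OF i] by blast
    qed
    then obtain x y where xy: "\<And>i. i < Suc m \<Longrightarrow> x i \<in> carrier G \<and> y i \<in> carrier G \<and>
        \<phi> i (x i) \<otimes> \<phi> i (y i) \<otimes> inv (\<phi> i (x i)) \<otimes> inv (\<phi> i (y i)) \<notin> D2" by metis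
    have cl: "\<phi> i z \<in> carrier G" if "i < Suc m" "z \<in> carrier G" for i z
      using hom[OF that(1)] that(2) by (rule hom_in_carrier)
    have P_comm: "(D2 #> a) \<otimes>\<^bsub>P\<^esub> (D2 #> b) = (D2 #> b) \<otimes>\<^bsub>P\<^esub> (D2 #> a)"
      if "a \<in> carrier G" "b \<in> carrier G" "a \<otimes> b = b \<otimes> a" for a b
      using that by (metis h.hom_mult)
    have "separated_family P {..<Suc m} (\<lambda>i. D2 #> \<phi> i (x i)) (\<lambda>i. D2 #> \<phi> i (y i))"
      unfolding separated_family_def
    proof (intro conjI ballI impI)
      fix i assume "i \<in> {..<Suc m}"
      then have i: "i < Suc m" by simp
      show "D2 #> \<phi> i (x i) \<in> carrier P" "D2 #> \<phi> i (y i) \<in> carrier P"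
        using cl[OF i] xy[OF i] by (simp_all add: h.hom_closed)
      show "(D2 #> \<phi> i (x i)) \<otimes>\<^bsub>P\<^esub> (D2 #> \<phi> i (y i)) \<noteq> (D2 #> \<phi> i (y i)) \<otimes>\<^bsub>P\<^esub> (D2 #> \<phi> i (x i))"
        using cl[OF i] xy[OF i] unfolding P_def by (simp only: D2.coset_commute_iff) simp
      fix j assume "j \<in> {..<Suc m}" "i \<noteq> j"
      then have j: "j < Suc m" "i \<noteq> j" by simp_all
      have xi: "x i \<in> carrier G" "y i \<in> carrier G" "x j \<in> carrier G" "y j \<in> carrier G"
        using xy[OF i] xy[OF j(1)] by simp_all
      show "(D2 #> \<phi> i (x i)) \<otimes>\<^bsub>P\<^esub> (D2 #> \<phi> j (x j)) = (D2 #> \<phi> j (x j)) \<otimes>\<^bsub>P\<^esub> (D2 #> \<phi> i (x i))"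
        "(D2 #> \<phi> i (x i)) \<otimes>\<^bsub>P\<^esub> (D2 #> \<phi> j (y j)) = (D2 #> \<phi> j (y j)) \<otimes>\<^bsub>P\<^esub> (D2 #> \<phi> i (x i))"
        "(D2 #> \<phi> i (y i)) \<otimes>\<^bsub>P\<^esub> (D2 #> \<phi> j (y j)) = (D2 #> \<phi> j (y j)) \<otimes>\<^bsub>P\<^esub> (D2 #> \<phi> i (y i))"
        by (intro P_comm cl comm i j xi)+
    qed
    then show False using m[of "{..<Suc m}"] by fastforce
  qed
  then have "x \<otimes> y = y \<otimes> x" if "x \<in> carrier G" "y \<in> carrier G" for x y
    using commutator_in_derived[of x "carrier G" y] commutator_eq_one_iff[of x y] that by (auto simp: D_def)
  then show ?thesis by (intro group_comm_groupI)
qed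

end

section \<open>Discriminating abelian groups\<close>

context comm_group
begin

lemma finite_generate_torsion:
  assumes a: "a \<in> carrier G" "a [^] (n::nat) = \<one>" "n > 0"
  shows "finite (generate G {a})"
proof -
  have "generate G {a} \<subseteq> (\<lambda>i::int. a [^] i) ` {0..<int n}"
  proof
    fix x assume "x \<in> generate G {a}"
    then obtain k :: int where k: "x = a [^] k" using generate_pow[OF a(1)] by auto
    have "a [^] k = a [^] (int n * (k div int n) + k mod int n)" by simp
    also have "\<dots> = (a [^] int n) [^] (k div int n) \<otimes> a [^] (k mod int n)"
      using a(1) by (simp only: int_pow_mult int_pow_pow)
    also have "\<dots> = a [^] (k mod int n)" using a by (simp add: int_pow_int)
    finally show "x \<in> (\<lambda>i::int. a [^] i) ` {0..<int n}" using k a(3) by auto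
  qed
  then show ?thesis by (rule finite_subset) simp
qed

text \<open>The product of a maximal finite subgroup \<open>F\<close> with a copy \<open>R\<close>
  of \<open>F \<times> F\<close> is again finite, so \<open>R\<close> lies in \<open>F\<close>.
  Counting gives \<open>card F * card F \<le> card F\<close>, which makes \<open>F\<close>
  trivial.\<close>

lemma discriminating_torsion_free:
  assumes disc: "discriminating G" and fg: "finitely_generated_group G"
    and a: "a \<in> carrier G" "a [^] (n::nat) = \<one>" "n > 0"
  shows "a = \<one>"
proof -
  obtain S where S: "finite S" "S \<subseteq> carrier G" "generate G S = carrier G"
    using fg unfolding finitely_generated_group_def by blast
  \<comment> \<open>A finitely generated abelian group satisfies the chain condition for all
    subgroups, which yields the maximal finite subgroup.\<close>
  obtain M where M: "subgroup M G" "S \<subseteq> M" "noeth_under G {} M"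
    using noeth_under_finite_subset[OF subgroup_self m_comm S(1,2)] by blast
  have "M = carrier G" using generate_subgroup_incl[OF M(2,1)] S(3) subgroup.subset[OF M(1)] by simp
  then have noeth: "noeth_under G {} (carrier G)" using M(3) by simp
  have cl: "conj_closed G {} K" for K by (simp add: conj_closed_def)
  obtain F where F: "subgroup F G" "finite F" "a \<in> F"
    and maxi: "\<And>K. subgroup K G \<Longrightarrow> finite K \<Longrightarrow> F \<subseteq> K \<Longrightarrow> a \<in> K \<Longrightarrow> K = F"
  proof (rule noeth_under_maximal[OF noeth, of "generate G {a}" "\<lambda>K. finite K \<and> a \<in> K"])
    show "subgroup (generate G {a}) G" using a by (intro generate_is_subgroup) simp
    show "generate G {a} \<subseteq> carrier G" using a by (intro generate_incl) simp
    show "finite (generate G {a}) \<and> a \<in> generate G {a}"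
      using finite_generate_torsion[OF a] by (auto intro: generate.incl)
  qed (use cl subgroup.subset in \<open>metis\<close>)+
  have Fc: "F \<subseteq> carrier G" by (rule subgroup.subset[OF F(1)])
  interpret GG: group "G \<times>\<times> G" by (rule DirProd_group[OF is_group is_group])
  have FF: "subgroup (F \<times> F) (G \<times>\<times> G)" by (rule DirProd_subgroups[OF is_group F(1) is_group F(1)])
  have "finite (F \<times> F)" "F \<times> F \<subseteq> carrier (G \<times>\<times> G)" using F(2) Fc by auto
  from discriminating_finite[OF disc this] obtain \<rho> where \<rho>: "\<rho> \<in> hom (G \<times>\<times> G) G"
    and ker: "\<And>t. t \<in> F \<times> F \<Longrightarrow> \<rho> t = \<one> \<longleftrightarrow> t = \<one>\<^bsub>G \<times>\<times> G\<^esub>" by blast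
  interpret r: group_hom "G \<times>\<times> G" G \<rho> using \<rho> by unfold_locales
  \<comment> \<open>\<open>F \<times> F\<close> is both the finite test set and a subgroup, so
    detecting its nontrivial elements amounts to injectivity.\<close>
  have "inj_on \<rho> (F \<times> F)"
  proof (rule inj_onI)
    fix s t assume st: "s \<in> F \<times> F" "t \<in> F \<times> F" "\<rho> s = \<rho> t"
    have stc: "s \<in> carrier (G \<times>\<times> G)" "t \<in> carrier (G \<times>\<times> G)" using st Fc by auto
    have "s \<otimes>\<^bsub>G \<times>\<times> G\<^esub> inv\<^bsub>G \<times>\<times> G\<^esub> t \<in> F \<times> F"
      using st FF by (meson subgroup.m_closed subgroup.m_inv_closed)
    moreover have "\<rho> (s \<otimes>\<^bsub>G \<times>\<times> G\<^esub> inv\<^bsub>G \<times>\<times> G\<^esub> t) = \<one>"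
      using stc st(3) r.hom_closed[OF stc(2)]
      by (simp only: r.hom_mult r.hom_inv GG.inv_closed r_inv)
    ultimately have "s \<otimes>\<^bsub>G \<times>\<times> G\<^esub> inv\<^bsub>G \<times>\<times> G\<^esub> t = \<one>\<^bsub>G \<times>\<times> G\<^esub>"
      by (simp only: ker)
    then have "s = \<one>\<^bsub>G \<times>\<times> G\<^esub> \<otimes>\<^bsub>G \<times>\<times> G\<^esub> t"
      by (rule iffD1[OF GG.inv_solve_right'[OF GG.one_closed stc]])
    then show "s = t" using stc(2) by (simp only: GG.l_one)
  qed
  then have card: "card (\<rho> ` (F \<times> F)) = card F * card F" by (simp add: card_image card_cartesian_product)
  define R where "R = \<rho> ` (F \<times> F)"
  have R: "subgroup R G" "finite R" using r.subgroup_img_is_subgroup[OF FF] F(2) by (auto simp: R_def)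
  have "F <#> R = F"
  proof (rule maxi)
    show "subgroup (F <#> R) G" by (rule mult_subgroups[OF F(1) R(1)])
    show "finite (F <#> R)" using F(2) R(2) by (auto simp: set_mult_def)
    show "F \<subseteq> F <#> R"
    proof
      fix x assume "x \<in> F"
      then show "x \<in> F <#> R"
        using Fc subgroup.one_closed[OF R(1)] by (force simp: set_mult_def)
    qed
    then show "a \<in> F <#> R" using F(3) by blast
  qed
  moreover have "R \<subseteq> F <#> R"
    using subgroup.one_closed[OF F(1)] subgroup.subset[OF R(1)] by (force simp: set_mult_def)
  ultimately have "card R \<le> card F" using F(2) by (intro card_mono) auto
  then have "card F * card F \<le> card F" using card by (simp add: R_def)
  then have "card F \<le> 1" by (cases "card F") auto
  then show ?thesis using F subgroup.one_closed[OF F(1)] by (metis card_le_Suc0_iff_eq One_nat_def)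
qed

text \<open>For a nontrivial pair \<open>(a, b)\<close> at most one \<open>M\<close> satisfies
  \<open>a \<otimes> b [^] M = \<one>\<close>: two such exponents would make a power of
  \<open>b\<close> trivial, hence \<open>b\<close> and then \<open>a\<close>. So some
  \<open>M\<close> avoids all bad exponents.\<close>

lemma torsion_free_discriminating:
  assumes tf: "\<And>a n. a \<in> carrier G \<Longrightarrow> a [^] (n::nat) = \<one> \<Longrightarrow> n > 0 \<Longrightarrow> a = \<one>"
  shows "discriminating G"
  unfolding discriminating_def
proof (intro allI impI)
  fix N :: nat and h :: "nat \<Rightarrow> 'a \<times> 'a"
  assume hc: "\<forall>i<N. h i \<in> carrier (G \<times>\<times> G)"
  define B where "B i = {M :: nat. h i \<noteq> (\<one>, \<one>) \<and> fst (h i) \<otimes> snd (h i) [^] M = \<one>}" for i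
  have le: False if ab: "a \<in> carrier G" "b \<in> carrier G" "(a, b) \<noteq> (\<one>, \<one>)"
    "a \<otimes> b [^] M = \<one>" "a \<otimes> b [^] M' = \<one>" "M < M'" for a b and M M' :: nat
  proof -
    have "b [^] M = b [^] M'" using ab by (metis nat_pow_closed inv_unique' inv_equality inv_inv m_comm)
    also have "\<dots> = b [^] M \<otimes> b [^] (M' - M)" using ab by (simp add: nat_pow_mult)
    finally have "b [^] (M' - M) = \<one>" using ab by simp
    then have "b = \<one>" using tf[of b "M' - M"] ab by simp
    then show False using ab by simp
  qed
  have "finite (B i)" if "i < N" for i
  proof -
    have "h i \<in> carrier G \<times> carrier G" using hc that by simp
    then have "M = M'" if "M \<in> B i" "M' \<in> B i" for M M'
      using that le[of "fst (h i)" "snd (h i)" M M'] le[of "fst (h i)" "snd (h i)" M' M]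
      by (cases "h i") (auto simp: B_def dest: linorder_neqE_nat)
    \<comment> \<open>\<open>B i\<close> has at most one element; if it is empty, the arbitrary
      value of \<open>SOME\<close> does no harm.\<close>
    then have "B i \<subseteq> {SOME M. M \<in> B i}" by (metis singletonI someI subsetI)
    then show ?thesis by (rule finite_subset) simp
  qed
  then have "finite (\<Union>i<N. B i)" by simp
  then obtain M where M: "M \<notin> (\<Union>i<N. B i)" using ex_new_if_finite infinite_UNIV_nat by blast
  define \<rho> where "\<rho> = (\<lambda>(a, b). a \<otimes> b [^] M)"
  have "\<rho> \<in> hom (G \<times>\<times> G) G"
  proof (rule homI)
    show "\<rho> u \<in> carrier G" if "u \<in> carrier (G \<times>\<times> G)" for u using that by (auto simp: \<rho>_def)
    show "\<rho> (u \<otimes>\<^bsub>G \<times>\<times> G\<^esub> v) = \<rho> u \<otimes> \<rho> v" if "u \<in> carrier (G \<times>\<times> G)" "v \<in> carrier (G \<times>\<times> G)" for u v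
      using that by (auto simp: \<rho>_def nat_pow_distrib m_ac)
  qed
  moreover have "\<rho> (h i) = \<one> \<longleftrightarrow> h i = \<one>\<^bsub>G \<times>\<times> G\<^esub>" if "i < N" for i
  proof -
    have "M \<notin> B i" using that M by blast
    then show ?thesis by (cases "h i") (auto simp: B_def \<rho>_def)
  qed
  ultimately show "\<exists>\<rho>\<in>hom (G \<times>\<times> G) G. \<forall>i<N. \<rho> (h i) = \<one> \<longleftrightarrow> h i = \<one>\<^bsub>G \<times>\<times> G\<^esub>" by blast
qed

end

subsection \<open>Finitely generated torsion-free abelian groups\<close>

lemma group_Zpow: "group (Zpow n)"
  by (simp add: Zpow_def)

context comm_group
begin

text \<open>The linear map from \<open>Zpow d\<close> sending the standard basis to the
  \<open>g k\<close>, in multiplicative notation. It reads only the coefficients below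
  \<open>d\<close>, so relations can be updated without being kept extensional.\<close>

definition int_comb :: "nat \<Rightarrow> (nat \<Rightarrow> 'a) \<Rightarrow> (nat \<Rightarrow> int) \<Rightarrow> 'a" where
  "int_comb d g v = finprod G (\<lambda>k. g k [^] v k) {..<d}"

lemma int_comb_hom:
  assumes g: "g \<in> {..<d} \<rightarrow> carrier G"
  shows "int_comb d g \<in> hom (Zpow d) G"
proof (rule homI)
  show "int_comb d g v \<in> carrier G" for v
    using g unfolding int_comb_def by (intro finprod_closed) auto
  show "int_comb d g (v \<otimes>\<^bsub>Zpow d\<^esub> w) = int_comb d g v \<otimes> int_comb d g w" for v w
  proof -
    have "int_comb d g (v \<otimes>\<^bsub>Zpow d\<^esub> w) = finprod G (\<lambda>k. g k [^] v k \<otimes> g k [^] w k) {..<d}"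
      unfolding int_comb_def
      by (rule finprod_cong') (use g in \<open>auto simp: Zpow_def int_pow_mult Pi_iff\<close>)
    also have "\<dots> = int_comb d g v \<otimes> int_comb d g w"
      unfolding int_comb_def by (rule finprod_multf) (use g in auto)
    finally show ?thesis .
  qed
qed

lemma int_comb_single:
  assumes g: "g \<in> {..<d} \<rightarrow> carrier G" and i: "i < d" and v: "\<And>k. k < d \<Longrightarrow> k \<noteq> i \<Longrightarrow> v k = 0"
  shows "int_comb d g v = g i [^] v i"
proof -
  have "int_comb d g v = finprod G (\<lambda>k. if i = k then g k [^] v k else \<one>) {..<d}"
    unfolding int_comb_def by (rule finprod_cong') (use g v in \<open>auto simp: Pi_iff\<close>)
  also have "\<dots> = g i [^] v i"
    using g i by (intro finprod_singleton) auto
  finally show ?thesis .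
qed

lemma int_comb_surj:
  assumes g: "g \<in> {..<d} \<rightarrow> carrier G" and gen: "generate G (g ` {..<d}) = carrier G"
  shows "int_comb d g ` carrier (Zpow d) = carrier G"
proof -
  interpret h: group_hom "Zpow d" G "int_comb d g"
    using int_comb_hom[OF g] group_Zpow by (simp add: group_hom_def group_hom_axioms_def is_group)
  have "g i \<in> int_comb d g ` carrier (Zpow d)" if i: "i < d" for i
  proof -
    define v :: "nat \<Rightarrow> int" where "v = (\<lambda>k\<in>{..<d}. if k = i then 1 else 0)"
    have "int_comb d g v = g i [^] v i" by (rule int_comb_single[OF g i]) (simp add: v_def)
    moreover have "g i \<in> carrier G" using g i by auto
    ultimately have "int_comb d g v = g i" using i by (simp add: v_def)
    moreover have "v \<in> carrier (Zpow d)" by (simp add: v_def Zpow_def)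
    ultimately show ?thesis by (metis image_eqI)
  qed
  then have "g ` {..<d} \<subseteq> int_comb d g ` carrier (Zpow d)" by auto
  then have "carrier G \<subseteq> int_comb d g ` carrier (Zpow d)"
    using generate_subgroup_incl h.img_is_subgroup gen by metis
  then show ?thesis using h.hom_closed by blast
qed

text \<open>The new \<open>j\<close>-th entry contributes an extra factor
  \<open>g i [^] (e * v j)\<close>, which the new \<open>i\<close>-th coefficient takes
  away.\<close>

lemma int_comb_elementary_change:
  assumes g: "g \<in> {..<d} \<rightarrow> carrier G" and ij: "i < d" "j < d" "i \<noteq> j"
  shows "int_comb d (g(j := g j \<otimes> g i [^] e)) (v(i := v i - e * v j)) = int_comb d g v"
proof -
  define R where "R = {..<d} - {i, j}"
  have D: "{..<d} = insert i (insert j R)" and R: "finite R" "i \<notin> insert j R" "j \<notin> R"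
    using ij by (auto simp: R_def)
  have gc: "g k \<in> carrier G" if "k \<in> insert i (insert j R)" for k using g that D by blast
  have split: "int_comb d f w = f i [^] w i \<otimes> (f j [^] w j \<otimes> finprod G (\<lambda>k. f k [^] w k) R)"
    if "\<And>k. k \<in> insert i (insert j R) \<Longrightarrow> f k \<in> carrier G" for f and w :: "nat \<Rightarrow> int"
    unfolding int_comb_def D using R that by (subst finprod_insert; (subst finprod_insert)?) auto
  define P where "P = finprod G (\<lambda>k. g k [^] v k) R"
  have Pc: "P \<in> carrier G" unfolding P_def using gc by (intro finprod_closed) auto
  define g' where "g' = g(j := g j \<otimes> g i [^] e)"
  define v' where "v' = v(i := v i - e * v j)"
  have g'c: "g' k \<in> carrier G" if "k \<in> insert i (insert j R)" for k
    using gc[OF that] gc[of i] gc[of j] by (simp add: g'_def)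
  have vals: "g' i = g i" "g' j = g j \<otimes> g i [^] e" "v' i = v i - e * v j" "v' j = v j"
    using ij by (simp_all add: g'_def v'_def)
  have rest: "finprod G (\<lambda>k. g' k [^] v' k) R = P"
    unfolding P_def by (rule finprod_cong') (use gc R in \<open>auto simp: g'_def v'_def\<close>)
  have "int_comb d g' v' = g i [^] (v i - e * v j) \<otimes> ((g j \<otimes> g i [^] e) [^] v j \<otimes> P)"
    using split[of g' v', OF g'c] by (simp only: rest vals)
  also have "\<dots> = (g i [^] (v i - e * v j) \<otimes> g i [^] (e * v j)) \<otimes> (g j [^] v j \<otimes> P)"
    using gc Pc by (simp add: int_pow_distrib int_pow_pow m_ac)
  also have "g i [^] (v i - e * v j) \<otimes> g i [^] (e * v j) = g i [^] v i"
    using gc by (simp flip: int_pow_mult)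
  finally have "int_comb d g' v' = g i [^] v i \<otimes> (g j [^] v j \<otimes> P)" .
  moreover have "int_comb d g v = g i [^] v i \<otimes> (g j [^] v j \<otimes> P)" unfolding P_def by (rule split[OF gc])
  ultimately show ?thesis by (simp only: g'_def v'_def)
qed

text \<open>The change is undone by multiplying the new \<open>j\<close>-th entry by
  \<open>g i [^] (- e)\<close>.\<close>

lemma generate_elementary_change:
  assumes g: "g \<in> {..<d} \<rightarrow> carrier G" and gen: "generate G (g ` {..<d}) = carrier G"
    and ij: "i < d" "j < d" "i \<noteq> j"
  shows "generate G ((g(j := g j \<otimes> g i [^] (e::int))) ` {..<d}) = carrier G"
proof -
  define g' where "g' = g(j := g j \<otimes> g i [^] e)"
  define H where "H = generate G (g' ` {..<d})"
  have gc: "g k \<in> carrier G" if "k < d" for k using g that by auto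
  have g'c: "g' ` {..<d} \<subseteq> carrier G" using gc ij by (auto simp: g'_def)
  have H: "subgroup H G" unfolding H_def by (rule generate_is_subgroup[OF g'c])
  have g'H: "g' k \<in> H" if "k < d" for k unfolding H_def using that by (intro generate.incl) auto
  have giH: "g i \<in> H" using g'H[OF ij(1)] ij by (simp add: g'_def)
  have "g k \<in> H" if "k < d" for k
  proof (cases "k = j")
    case True
    have "g' j \<otimes> g i [^] (- e) \<in> H"
      using subgroup.m_closed[OF H g'H[OF ij(2)] subgroup_int_pow_closed[OF H giH]] .
    moreover have "g' j \<otimes> g i [^] (- e) = g j"
      using gc[OF ij(1)] gc[OF ij(2)] by (simp add: g'_def m_assoc flip: int_pow_mult)
    ultimately show ?thesis using True by simp
  next
    case False
    then show ?thesis using g'H[OF that] by (simp add: g'_def)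
  qed
  then have "carrier G \<subseteq> H" using generate_subgroup_incl[OF _ H, of "g ` {..<d}"] gen by auto
  then show ?thesis using subgroup.subset[OF H] by (auto simp: H_def g'_def)
qed

text \<open>Among all generating tuples of minimal length and nontrivial relations \<open>v\<close> between their
  entries, one minimising the sum of the \<open>\<bar>v k\<bar>\<close> would have a single nonzero coefficient, by
  Euclidean descent.\<close>

lemma torsion_free_iso_Zpow:
  assumes fg: "finitely_generated_group G"
    and tf: "\<And>a n. a \<in> carrier G \<Longrightarrow> a [^] (n::nat) = \<one> \<Longrightarrow> n > 0 \<Longrightarrow> a = \<one>"
  shows "\<exists>n. G \<cong> Zpow n"
proof -
  define Q where "Q d \<longleftrightarrow> (\<exists>S. finite S \<and> card S = d \<and> S \<subseteq> carrier G \<and> generate G S = carrier G)" for d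
  have "\<exists>d. Q d" using fg by (auto simp: Q_def finitely_generated_group_def)
  define d where "d = (LEAST d. Q d)"
  have Qd: "Q d" unfolding d_def using \<open>\<exists>d. Q d\<close> by (rule LeastI_ex)
  have dmin: "d \<le> card S" if "finite S" "S \<subseteq> carrier G" "generate G S = carrier G" for S
    unfolding d_def using that by (intro Least_le) (auto simp: Q_def)
  define good where "good g \<longleftrightarrow> g \<in> {..<d} \<rightarrow> carrier G \<and> generate G (g ` {..<d}) = carrier G" for g
  have no_relation: "\<not> (good g \<and> int_comb d g v = \<one> \<and> (\<exists>i<d. v i \<noteq> 0))" for g v
  proof (induction "\<Sum>k<d. nat \<bar>v k\<bar>" arbitrary: g v rule: less_induct)
    case less
    show ?case
    proof
      assume "good g \<and> int_comb d g v = \<one> \<and> (\<exists>i<d. v i \<noteq> 0)"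
      then obtain i0 where good: "good g" and rel: "int_comb d g v = \<one>" and i0: "i0 < d" "v i0 \<noteq> 0" by blast
      have g: "g \<in> {..<d} \<rightarrow> carrier G" and gen: "generate G (g ` {..<d}) = carrier G"
        using good by (auto simp: good_def)
      show False
      proof (cases "\<exists>j<d. j \<noteq> i0 \<and> v j \<noteq> 0")
        case False
        \<comment> \<open>A single nonzero coefficient makes \<open>g i0\<close> a torsion element,
          hence trivial, and removing it contradicts the minimality of \<open>d\<close>.\<close>
        then have "int_comb d g v = g i0 [^] v i0" by (intro int_comb_single[OF g i0(1)]) blast
        then have "g i0 [^] v i0 = \<one>" using rel by simp
        moreover have gi0: "g i0 \<in> carrier G" using g i0 by auto
        ultimately have "g i0 [^] \<bar>v i0\<bar> = \<one>"
          unfolding abs_if by (simp add: int_pow_neg)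
        then have "g i0 [^] nat \<bar>v i0\<bar> = \<one>" by simp
        then have one: "g i0 = \<one>" by (rule tf[OF gi0]) (use i0 in simp)
        define S where "S = g ` ({..<d} - {i0})"
        have S: "finite S" "S \<subseteq> carrier G" using g by (auto simp: S_def)
        have "g k \<in> generate G S" if "k < d" for k
        proof (cases "k = i0")
          case True
          then show ?thesis using one by (simp only: generate.one)
        next
          case False
          then show ?thesis using that unfolding S_def by (intro generate.incl) simp
        qed
        then have "g ` {..<d} \<subseteq> generate G S" by auto
        then have "generate G S = carrier G"
          using generate_subgroup_incl[OF _ generate_is_subgroup[OF S(2)]] gen generate_incl[OF S(2)] by blast
        then have "d \<le> card S" using dmin S by blast
        also have "card S \<le> card ({..<d} - {i0})" unfolding S_def by (rule card_image_le) simp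
        also have "\<dots> < d" using i0 by simp
        finally show False by simp
      next
        case True
        then obtain j0 where j0: "j0 < d" "j0 \<noteq> i0" "v j0 \<noteq> 0" by blast
        obtain i j where ij: "i < d" "j < d" "i \<noteq> j" "v j \<noteq> 0" "\<bar>v j\<bar> \<le> \<bar>v i\<bar>"
        proof (cases "\<bar>v i0\<bar> \<le> \<bar>v j0\<bar>")
          case True
          then show ?thesis using that[of j0 i0] i0 j0 by simp
        next
          case False
          then show ?thesis using that[of i0 j0] i0 j0 by simp
        qed
        \<comment> \<open>With this sign \<open>\<bar>v i - e * v j\<bar> = \<bar>v i\<bar> -
          \<bar>v j\<bar>\<close>, while \<open>v j\<close> stays nonzero.\<close>
        define e where "e = sgn (v i) * sgn (v j)"
        define v' where "v' = v(i := v i - e * v j)"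
        define g' where "g' = g(j := g j \<otimes> g i [^] e)"
        have "good g'"
          using generate_elementary_change[OF g gen ij(1-3)] g ij by (auto simp: good_def g'_def Pi_iff)
        moreover have "int_comb d g' v' = \<one>"
          using int_comb_elementary_change[OF g ij(1-3)] rel by (simp add: g'_def v'_def)
        moreover have "\<exists>i<d. v' i \<noteq> 0" using ij by (auto simp: v'_def)
        moreover have "(\<Sum>k<d. nat \<bar>v' k\<bar>) < (\<Sum>k<d. nat \<bar>v k\<bar>)"
        proof (rule sum_strict_mono_ex1)
          have "\<bar>v i - e * v j\<bar> < \<bar>v i\<bar>"
            using ij(4,5) by (auto simp: e_def sgn_if abs_if split: if_splits)
          then have lt: "nat \<bar>v' i\<bar> < nat \<bar>v i\<bar>" by (simp add: v'_def)
          then show "\<exists>k\<in>{..<d}. nat \<bar>v' k\<bar> < nat \<bar>v k\<bar>" using ij by blast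
          show "\<forall>k\<in>{..<d}. nat \<bar>v' k\<bar> \<le> nat \<bar>v k\<bar>" using lt by (auto simp: v'_def)
        qed simp
        ultimately show False using less by blast
      qed
    qed
  qed
  obtain S where S: "finite S" "card S = d" "S \<subseteq> carrier G" "generate G S = carrier G"
    using Qd by (auto simp: Q_def)
  obtain g where "bij_betw g {0..<d} S" using ex_bij_betw_nat_finite[OF S(1)] S(2) by blast
  then have img: "g ` {..<d} = S" by (simp add: bij_betw_def lessThan_atLeast0)
  then have good: "good g" using S by (auto simp: good_def)
  then have g: "g \<in> {..<d} \<rightarrow> carrier G" by (simp add: good_def)
  interpret h: group_hom "Zpow d" G "int_comb d g"
    using int_comb_hom[OF g] group_Zpow by (simp add: group_hom_def group_hom_axioms_def is_group)
  have "kernel (Zpow d) G (int_comb d g) = {\<one>\<^bsub>Zpow d\<^esub>}"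
  proof -
    have "v = \<one>\<^bsub>Zpow d\<^esub>" if "v \<in> carrier (Zpow d)" "int_comb d g v = \<one>" for v
    proof -
      \<comment> \<open>Elements of \<open>Zpow d\<close> are extensional, so vanishing below
        \<open>d\<close> identifies the neutral element.\<close>
      have "\<forall>i<d. v i = 0" using no_relation[of g v] good that(2) by blast
      then show ?thesis
        using that(1) by (auto simp: Zpow_def PiE_def extensional_def)
    qed
    then show ?thesis by (auto simp: kernel_def)
  qed
  then have "inj_on (int_comb d g) (carrier (Zpow d))" by (rule h.trivial_ker_imp_inj)
  moreover have "int_comb d g ` carrier (Zpow d) = carrier G"
    using int_comb_surj[OF g] good by (simp add: good_def)
  ultimately have "int_comb d g \<in> iso (Zpow d) G"
    using int_comb_hom[OF g] by (simp add: iso_def bij_betw_def)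
  then have "Zpow d \<cong> G" by (auto simp: is_iso_def)
  then show ?thesis using group.iso_sym[OF group_Zpow] by blast
qed

end

lemma (in group) iso_Zpow_comm_torsion_free:
  assumes "G \<cong> Zpow d"
  shows "comm_group G"
    and "\<And>a n. a \<in> carrier G \<Longrightarrow> a [^] (n::nat) = \<one> \<Longrightarrow> n > 0 \<Longrightarrow> a = \<one>"
proof -
  obtain f where "f \<in> iso G (Zpow d)" using assms by (auto simp: is_iso_def)
  then have hom: "f \<in> hom G (Zpow d)" and inj: "inj_on f (carrier G)" by (auto simp: iso_def bij_betw_def)
  interpret h: group_hom G "Zpow d" f
    using hom group_Zpow by (simp add: group_hom_def group_hom_axioms_def is_group)
  show "comm_group G"
  proof (rule group_comm_groupI)
    fix x y assume xy: "x \<in> carrier G" "y \<in> carrier G"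
    then have "f (x \<otimes> y) = f (y \<otimes> x)" by (simp add: Zpow_def add.commute)
    from inj_onD[OF inj this] xy show "x \<otimes> y = y \<otimes> x" by simp
  qed
  fix a and n :: nat assume a: "a \<in> carrier G" "a [^] n = \<one>" "n > 0"
  \<comment> \<open>Powers turn into coordinatewise multiples in \<open>Zpow d\<close>, so a torsion
    element has all coordinates zero.\<close>
  have pow: "f (a [^] m) = (\<lambda>k\<in>{..<d}. int m * f a k)" for m
  proof (induction m)
    case 0
    then show ?case using h.hom_one by (simp add: Zpow_def)
  next
    case (Suc m)
    have "f (a [^] Suc m) = f (a [^] m) \<otimes>\<^bsub>Zpow d\<^esub> f a" using a(1) by (simp add: h.hom_mult)
    then show ?case using Suc by (auto simp: Zpow_def algebra_simps)
  qed
  have fa: "f a \<in> extensional {..<d}" using h.hom_closed[OF a(1)] by (simp add: Zpow_def PiE_def)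
  have one: "f \<one> = (\<lambda>k\<in>{..<d}. 0)" using h.hom_one by (simp add: Zpow_def)
  have "int n * f a k = 0" if "k < d" for k
    using fun_cong[OF pow[of n], of k] fun_cong[OF one, of k] a(2) that by simp
  then have "f a = f \<one>" unfolding one using a(3) fa by (auto simp: extensional_def)
  then show "a = \<one>" by (rule inj_onD[OF inj _ a(1) one_closed])
qed

theorem theorem6p6:
  fixes G :: "('a, 'b) monoid_scheme"
  assumes "group G" and "finitely_generated_group G" and "solvable G"
  shows "discriminating G \<longleftrightarrow> (\<exists>n::nat. G \<cong> Zpow n)"
proof
  interpret group G by fact
  assume disc: "discriminating G"
  then interpret comm_group G using discriminating_solvable_abelian assms(2,3) by blast
  show "\<exists>n. G \<cong> Zpow n"
    using torsion_free_iso_Zpow[OF assms(2)] discriminating_torsion_free[OF disc assms(2)] by blast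
next
  interpret group G by fact
  assume "\<exists>n. G \<cong> Zpow n"
  then obtain n where n: "G \<cong> Zpow n" by blast
  interpret comm_group G by (rule iso_Zpow_comm_torsion_free(1)[OF n])
  show "discriminating G"
    by (rule torsion_free_discriminating) (rule iso_Zpow_comm_torsion_free(2)[OF n])
qed

end
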